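(* A ruled hypersurface (of codimension 2) in $\mathbb P^{n+3}$ is the ruled hypersurface of a Hamiltonian system $$u^i_t=\varepsilon^i\frac{d}{dx}\left(\frac{\partial h(u)}{\partial u^i}\right),\qquad i=1,\dots,n\quad(\text{no summation}),\qquad \varepsilon^i=\pm1,$$ if and only if its line generators form a Legendre submanifold of the Fano variety $F_{1,n+2}$ of lines of some smooth quadric in $\mathbb P^{n+3}$, with respect to the contact structure $\tau$ on $F_{1,n+2}$.
   Context: All considerations are local and smooth, over $\mathbb R$; geometric objects in $\mathbb P^{n+3}$ are considered up to projective equivalence. A ruled hypersurface of codimension 2 in $\mathbb P^{n+3}$ is an $(n+1)$-dimensional submanifold swept out by an $n$-parameter family of lines (its line generators). Ruled hypersurface of a Hamiltonian system. Put $h_i=\partial h/\partial u^i$, $\nabla h=(h_1,\dots,h_n)$, $|v|^2=\sum_i\varepsilon^i(v_i)^2$. The system has the $n+2$ conservation laws $u^i\,dx+\varepsilon^ih_i\,dt$ ($i=1,\dots,n$), $\frac12|u|^2\,dx+(\sum_ih_iu^i-h)\,dt$, $h\,dx+\frac12|\nabla h|^2\,dt$. Its ruled hypersurface is the union of the lines (parametrized by $u$) spanned by the points $$p=[1:u^1:\dots:u^n:\tfrac12|u|^2:h:0],\qquad r=[0:\varepsilon^1h_1:\dots:\varepsilon^nh_n:\textstyle\sum_ih_iu^i-h:\tfrac12|\nabla h|^2:1].$$ Contact structure. Let $Q=\{(X,X)=0\}\subset\mathbb P^{n+3}$ be a smooth quadric given by a nondegenerate symmetric bilinear form $(\cdot,\cdot)$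 on $\mathbb R^{n+4}$, and let $F_{1,n+2}$ be the $(2n+1)$-dimensional Fano variety of (real) lines on $Q$. For $l\in F_{1,n+2}$, the projectivization of a plane $\Lambda$, the tangent space $T_lF_{1,n+2}$ consists of those $\overline\varphi\in\mathrm{Hom}(\Lambda,\mathbb R^{n+4}/\Lambda)$ whose representatives $\varphi\in \mathrm{Hom}(\Lambda,\mathbb R^{n+4})$ satisfy $(X,\varphi(X))=(Y,\varphi(Y))=(X,\varphi(Y))+(Y,\varphi(X))=0$ for a basis $X,Y$ of $\Lambda$. The codimension one distribution $\tau$ on $F_{1,n+2}$ is defined by the additional constraint $(X,\varphi(Y))=0$; it is a contact structure. A Legendre submanifold is an $n$-dimensional submanifold of $F_{1,n+2}$ that is everywhere tangent to $\tau$. *)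

theory Defs
  imports "HOL-Analysis.Analysis"
begin

text \<open>\<open>C\<^sup>\<infinity>\<close> in the usual sense when \<open>S\<close> is open, the only case used below.\<close>

primrec Ck_on ::
    "nat \<Rightarrow> 'a::euclidean_space set \<Rightarrow> ('a \<Rightarrow> 'b::real_normed_vector) \<Rightarrow> bool" where
  "Ck_on 0 S f \<longleftrightarrow> continuous_on S f"
| "Ck_on (Suc k) S f \<longleftrightarrow>
     (\<forall>x\<in>S. f differentiable (at x)) \<and>
     (\<forall>d. Ck_on k S (\<lambda>x. frechet_derivative f (at x) d))"

definition smooth_on :: "'a::euclidean_space set \<Rightarrow> ('a \<Rightarrow> 'b::real_normed_vector) \<Rightarrow> bool" where
  "smooth_on S f \<longleftrightarrow> (\<forall>k. Ck_on k S f)"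

text \<open>With \<open>n = CARD('n)\<close>, this is \<open>\<real>\<^sup>n\<^sup>+\<^sup>4\<close>, the space of homogeneous coordinates
  \<open>[X\<^sup>0 : X\<^sup>1 : \<dots> : X\<^sup>n : X\<^sup>n\<^sup>+\<^sup>1 : X\<^sup>n\<^sup>+\<^sup>2 : X\<^sup>n\<^sup>+\<^sup>3]\<close> on \<open>\<P>\<^sup>n\<^sup>+\<^sup>3\<close>. A line of \<open>\<P>\<^sup>n\<^sup>+\<^sup>3\<close> is represented by the
  2-dimensional subspace of which it is the projectivization, a projective transformation by a
  bijective linear map.\<close>

type_synonym 'n hcoords = "real \<times> (real ^ 'n) \<times> real \<times> real \<times> real"

type_synonym 'n line_family = "real ^ 'n \<Rightarrow> 'n hcoords set"

definition is_line :: "('n::finite) hcoords set \<Rightarrow> bool" where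
  "is_line \<Lambda> \<longleftrightarrow> subspace \<Lambda> \<and> dim \<Lambda> = 2"

definition local_frame ::
    "('n::finite) line_family \<Rightarrow> (real ^ 'n) set \<Rightarrow>
     (real ^ 'n \<Rightarrow> 'n hcoords) \<Rightarrow> (real ^ 'n \<Rightarrow> 'n hcoords) \<Rightarrow> bool" where
  "local_frame L V X Y \<longleftrightarrow> open V \<and> smooth_on V X \<and> smooth_on V Y \<and>
     (\<forall>v\<in>V. is_line (L v) \<and> L v = span {X v, Y v})"

definition smooth_line_family :: "(real ^ 'n::finite) set \<Rightarrow> 'n line_family \<Rightarrow> bool" where
  "smooth_line_family U L \<longleftrightarrow> open U \<and>
     (\<forall>v\<in>U. \<exists>V X Y. v \<in> V \<and> V \<subseteq> U \<and> local_frame L V X Y)"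

definition sweep ::
    "(real ^ 'n \<Rightarrow> 'n hcoords) \<Rightarrow> (real ^ 'n \<Rightarrow> 'n hcoords) \<Rightarrow>
     (real ^ 'n::finite) \<times> real \<times> real \<Rightarrow> 'n hcoords" where
  "sweep X Y = (\<lambda>(v, s, t). s *\<^sub>R X v + t *\<^sub>R Y v)"

text \<open>The lines sweep out a submanifold of dimension \<open>n + 1\<close>: every generator contains a point (hence
  all but finitely many of its points) at which the swept-out map into \<open>\<P>\<^sup>n\<^sup>+\<^sup>3\<close> is an immersion.
  Finitely many focal points on a generator are allowed; they do occur for ruled hypersurfaces of
  Hamiltonian systems. The immersion condition is expressed on the cone over the hypersurface: the
  map \<open>(v, [s : t]) \<mapsto> [s X(v) + t Y(v)]\<close> has rank \<open>n + 1\<close> at a point iff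
  \<open>(v, s, t) \<mapsto> s X(v) + t Y(v)\<close> has rank \<open>n + 2\<close> there. (For \<open>s = t = 0\<close> the latter has rank 2 only.)\<close>

definition ruled_hypersurface :: "(real ^ 'n::finite) set \<Rightarrow> 'n line_family \<Rightarrow> bool" where
  "ruled_hypersurface U L \<longleftrightarrow> open U \<and>
     (\<forall>v\<in>U. \<exists>V X Y. v \<in> V \<and> V \<subseteq> U \<and> local_frame L V X Y \<and>
        (\<exists>s t. inj (frechet_derivative (sweep X Y) (at (v, s, t)))))"

definition partial_deriv :: "(real ^ 'n \<Rightarrow> real) \<Rightarrow> 'n::finite \<Rightarrow> real ^ 'n \<Rightarrow> real" where
  "partial_deriv h i u = frechet_derivative h (at u) (axis i 1)"

definition grad :: "(real ^ 'n::finite \<Rightarrow> real) \<Rightarrow> real ^ 'n \<Rightarrow> real ^ 'n" where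
  "grad h u = (\<chi> i. partial_deriv h i u)"

definition sqnorm :: "('n::finite \<Rightarrow> real) \<Rightarrow> real ^ 'n \<Rightarrow> real" where
  "sqnorm \<epsilon> v = (\<Sum>i\<in>UNIV. \<epsilon> i * (v $ i)\<^sup>2)"

text \<open>The system \<open>u\<^sup>i\<^sub>t = \<epsilon>\<^sup>i (h\<^sub>i)\<^sub>x\<close> is given by the data \<open>\<epsilon>\<close>, \<open>h\<close>. Its \<open>n + 2\<close> conservation laws
  are \<open>u\<^sup>i dx + \<epsilon>\<^sup>i h\<^sub>i dt\<close>, \<open>\<bar>u\<bar>\<^sup>2/2 dx + (\<Sum> h\<^sub>i u\<^sup>i - h) dt\<close> and \<open>h dx + \<bar>\<nabla>h\<bar>\<^sup>2/2 dt\<close>; the coefficients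
  of \<open>dx\<close> are the middle coordinates of \<open>ham_p\<close>, those of \<open>dt\<close> the middle coordinates of \<open>ham_r\<close>.\<close>

definition ham_p :: "('n::finite \<Rightarrow> real) \<Rightarrow> (real ^ 'n \<Rightarrow> real) \<Rightarrow> real ^ 'n \<Rightarrow> 'n hcoords" where
  "ham_p \<epsilon> h u = (1, u, sqnorm \<epsilon> u / 2, h u, 0)"

definition ham_r :: "('n::finite \<Rightarrow> real) \<Rightarrow> (real ^ 'n \<Rightarrow> real) \<Rightarrow> real ^ 'n \<Rightarrow> 'n hcoords" where
  "ham_r \<epsilon> h u =
     (0, (\<chi> i. \<epsilon> i * partial_deriv h i u), (\<Sum>i\<in>UNIV. partial_deriv h i u * u $ i) - h u,
      sqnorm \<epsilon> (grad h u) / 2, 1)"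

definition ham_line :: "('n::finite \<Rightarrow> real) \<Rightarrow> (real ^ 'n \<Rightarrow> real) \<Rightarrow> 'n line_family" where
  "ham_line \<epsilon> h u = span {ham_p \<epsilon> h u, ham_r \<epsilon> h u}"

text \<open>Ruled hypersurfaces are identified when they have the same line generators (and so the same
  union of lines), whatever the parametrization of these, up to a projective transformation \<open>A\<close>.\<close>

definition hamiltonian_ruled :: "(real ^ 'n::finite) set \<Rightarrow> 'n line_family \<Rightarrow> bool" where
  "hamiltonian_ruled V L \<longleftrightarrow>
     (\<exists>\<epsilon> h W (A :: 'n hcoords \<Rightarrow> 'n hcoords). (\<forall>i. \<epsilon> i = 1 \<or> \<epsilon> i = -1) \<and> open W \<and> smooth_on W h \<and>
        linear A \<and> bij A \<and> (\<lambda>v. A ` L v) ` V = ham_line \<epsilon> h ` W)"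

definition nondegenerate_form :: "(('n::finite) hcoords \<Rightarrow> 'n hcoords \<Rightarrow> real) \<Rightarrow> bool" where
  "nondegenerate_form B \<longleftrightarrow> bilinear B \<and> (\<forall>x y. B x y = B y x) \<and>
     (\<forall>x. (\<forall>y. B x y = 0) \<longrightarrow> x = 0)"

text \<open>The affine cone over the quadric.\<close>

definition quadric :: "(('n::finite) hcoords \<Rightarrow> 'n hcoords \<Rightarrow> real) \<Rightarrow> 'n hcoords set" where
  "quadric B = {x. B x x = 0}"

definition fano :: "(('n::finite) hcoords \<Rightarrow> 'n hcoords \<Rightarrow> real) \<Rightarrow> 'n hcoords set set" where
  "fano B = {\<Lambda>. is_line \<Lambda> \<and> \<Lambda> \<subseteq> quadric B}"

text \<open>Elements of \<open>Hom(\<Lambda>, \<real>\<^sup>n\<^sup>+\<^sup>4/\<Lambda>)\<close> are given by their representatives, extended from \<open>\<Lambda>\<close> to linear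
  maps on \<open>\<real>\<^sup>n\<^sup>+\<^sup>4\<close>; thus \<open>\<phi>\<close> and \<open>\<psi>\<close> represent the same element iff \<open>\<phi> x - \<psi> x \<in> \<Lambda>\<close> for all \<open>x \<in> \<Lambda>\<close>.
  For \<open>\<Lambda> \<in> fano B\<close> neither of the next two conditions depends on the representative or on the basis.\<close>

definition fano_tangent ::
    "(('n::finite) hcoords \<Rightarrow> 'n hcoords \<Rightarrow> real) \<Rightarrow> 'n hcoords set \<Rightarrow> ('n hcoords \<Rightarrow> 'n hcoords) set"
  where
  "fano_tangent B \<Lambda> = {\<phi>. linear \<phi> \<and>
     (\<exists>X Y. \<Lambda> = span {X, Y} \<and>
        B X (\<phi> X) = 0 \<and> B Y (\<phi> Y) = 0 \<and> B X (\<phi> Y) + B Y (\<phi> X) = 0)}"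

definition contact_plane ::
    "(('n::finite) hcoords \<Rightarrow> 'n hcoords \<Rightarrow> real) \<Rightarrow> 'n hcoords set \<Rightarrow> ('n hcoords \<Rightarrow> 'n hcoords) set"
  where
  "contact_plane B \<Lambda> = {\<phi> \<in> fano_tangent B \<Lambda>. \<exists>X Y. \<Lambda> = span {X, Y} \<and> B X (\<phi> Y) = 0}"

text \<open>The representatives of the derivative of the family \<open>L\<close> at \<open>v\<close> in the direction \<open>w\<close>, as an element
  of \<open>Hom(L v, \<real>\<^sup>n\<^sup>+\<^sup>4/L v)\<close>: it maps \<open>X(v)\<close> to \<open>dX\<^sub>v(w)\<close> mod \<open>L v\<close> for every smooth local section \<open>X\<close>.\<close>

definition family_deriv ::
    "('n::finite) line_family \<Rightarrow> real ^ 'n \<Rightarrow> real ^ 'n \<Rightarrow> ('n hcoords \<Rightarrow> 'n hcoords) set" where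
  "family_deriv L v w = {\<phi>. linear \<phi> \<and>
     (\<forall>V X. open V \<longrightarrow> v \<in> V \<longrightarrow> smooth_on V X \<longrightarrow> (\<forall>z\<in>V. X z \<in> L z) \<longrightarrow>
        \<phi> (X v) - frechet_derivative X (at v) w \<in> L v)}"

text \<open>The parameter space is \<open>n\<close>-dimensional and the derivative of the family is injective (it vanishes
  in the direction \<open>w\<close> iff its representatives map \<open>L v\<close> to itself), so that locally the lines form
  an \<open>n\<close>-dimensional submanifold.\<close>

definition legendre_submanifold ::
    "(('n::finite) hcoords \<Rightarrow> 'n hcoords \<Rightarrow> real) \<Rightarrow> (real ^ 'n) set \<Rightarrow> 'n line_family \<Rightarrow> bool" where
  "legendre_submanifold B V L \<longleftrightarrow>
     smooth_line_family V L \<and>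
     (\<forall>v\<in>V. L v \<in> fano B) \<and>
     (\<forall>v\<in>V. \<forall>w. \<forall>\<phi>\<in>family_deriv L v w. \<phi> ` L v \<subseteq> L v \<longrightarrow> w = 0) \<and>
     (\<forall>v\<in>V. \<forall>w. family_deriv L v w \<subseteq> contact_plane B (L v))"

end

theory Submission
  imports Defs
begin

text \<open>In coordinates where the quadric is \<open>\<Sum>\<epsilon>\<^sup>i(X\<^sup>i)\<^sup>2 = 2 X\<^sup>0 X\<^sup>n\<^sup>+\<^sup>1 + 2 X\<^sup>n\<^sup>+\<^sup>2 X\<^sup>n\<^sup>+\<^sup>3\<close>, a line on it
  which projects isomorphically to the coordinates \<open>X\<^sup>0, X\<^sup>n\<^sup>+\<^sup>3\<close> is spanned by unique points
  \<open>p = [1 : u : \<bar>u\<bar>\<^sup>2/2 : h : 0]\<close> and \<open>r = [0 : q : \<Sum>\<epsilon>\<^sup>iq\<^sup>iu\<^sup>i - h : \<bar>q\<bar>\<^sup>2/2 : 1]\<close>, and on a family of such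
  lines the contact condition \<open>(dp, r) = 0\<close> reads \<open>dh = \<Sum>\<epsilon>\<^sup>iq\<^sup>idu\<^sup>i\<close>. If \<open>u\<close> is a local coordinate system
  on the family, this says \<open>q\<^sup>i = \<epsilon>\<^sup>ih\<^sub>i\<close>, that is, the lines are those of the Hamiltonian system with
  density \<open>h\<close>. Since \<open>du = 0\<close> forces \<open>dp = 0\<close>, the map \<open>u\<close> is a local diffeomorphism as soon as \<open>p\<close> is a
  point at which the ruled hypersurface is immersed, and a Witt basis adapted to the generator
  makes any given point of it play the role of \<open>p\<close>.\<close>

section \<open>Smooth maps\<close>

text \<open>On an open set a derivative depends only on nearby values, so agreement on
  \<open>S\<close> passes to every directional derivative and the induction goes through.\<close>

lemma Ck_on_cong:
  assumes "open S" "\<And>x. x \<in> S \<Longrightarrow> f x = g x" "Ck_on k S f"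
  shows "Ck_on k S g"
  using assms(2,3)
proof (induction k arbitrary: f g)
  case 0
  then show ?case by (metis Ck_on.simps(1) continuous_on_eq)
next
  case (Suc k)
  have *: "(g has_derivative frechet_derivative f (at x)) (at x)" if "x \<in> S" for x
    using Suc.prems that assms(1)
    by (meson Ck_on.simps(2) frechet_derivative_works has_derivative_transform_within_open)
  have "Ck_on k S (\<lambda>x. frechet_derivative g (at x) d)" for d
    by (rule Suc.IH[of "\<lambda>x. frechet_derivative f (at x) d"])
      (use Suc.prems * frechet_derivative_at in \<open>fastforce+\<close>)
  with * show ?case by (auto simp: differentiable_def)
qed

lemma Ck_on_subset: "Ck_on k S f \<Longrightarrow> T \<subseteq> S \<Longrightarrow> Ck_on k T f"
  by (induction k arbitrary: f) (auto intro: continuous_on_subset)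

text \<open>Allows an explicit derivative in place of the chosen \<open>frechet_derivative\<close>,
  so that the differentiation rules can be fed directly into inductions on \<open>k\<close>.\<close>

lemma Ck_on_SucI:
  assumes "open S" "\<And>x. x \<in> S \<Longrightarrow> (f has_derivative f' x) (at x)"
    and "\<And>d. Ck_on k S (\<lambda>x. f' x d)"
  shows "Ck_on (Suc k) S f"
proof -
  have "Ck_on k S (\<lambda>x. frechet_derivative f (at x) d)" for d
    by (rule Ck_on_cong[OF assms(1) _ assms(3)[of d]]) (use assms(2) frechet_derivative_at in metis)
  then show ?thesis using assms(2) by (auto simp: differentiable_def)
qed

lemma Ck_on_Suc_has_derivative:
  "Ck_on (Suc k) S f \<Longrightarrow> x \<in> S \<Longrightarrow> (f has_derivative frechet_derivative f (at x)) (at x)"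
  by (simp add: frechet_derivative_works)

lemma Ck_on_SucD: "Ck_on (Suc k) S f \<Longrightarrow> Ck_on k S f"
proof (induction k arbitrary: f)
  case 0
  then show ?case
    by (simp add: differentiable_imp_continuous_on differentiable_on_def differentiable_at_withinI)
next
  case (Suc k)
  then show ?case by (metis Ck_on.simps(2))
qed

lemma Ck_on_const: "Ck_on k S (\<lambda>x. c)"
  by (induction k arbitrary: c) simp_all

lemma Ck_on_linear:
  assumes "open S" "bounded_linear F" "Ck_on k S f"
  shows "Ck_on k S (\<lambda>x. F (f x))"
  using assms(3)
proof (induction k arbitrary: f)
  case 0
  then show ?case using assms(2) by (simp add: bounded_linear.continuous_on)
next
  case (Suc k)
  show ?case
    by (rule Ck_on_SucI[OF assms(1) bounded_linear.has_derivative[OF assms(2)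
          Ck_on_Suc_has_derivative[OF Suc.prems]]])
      (use Suc in auto)
qed

lemma Ck_on_add:
  assumes "open S" "Ck_on k S f" "Ck_on k S g"
  shows "Ck_on k S (\<lambda>x. f x + g x)"
  using assms(2,3)
proof (induction k arbitrary: f g)
  case 0
  then show ?case by (simp add: continuous_on_add)
next
  case (Suc k)
  show ?case
    by (rule Ck_on_SucI[OF assms(1) has_derivative_add[OF Ck_on_Suc_has_derivative[OF Suc.prems(1)]
          Ck_on_Suc_has_derivative[OF Suc.prems(2)]]])
      (use Suc in auto)
qed

lemma Ck_on_scaleR:
  fixes f :: "'a::euclidean_space \<Rightarrow> real"
  assumes "open S" "Ck_on k S f" "Ck_on k S g"
  shows "Ck_on k S (\<lambda>x. f x *\<^sub>R g x)"
  using assms(2,3)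
proof (induction k arbitrary: f g)
  case 0
  then show ?case by (simp add: continuous_on_scaleR)
next
  case (Suc k)
  show ?case
    by (rule Ck_on_SucI[OF assms(1) has_derivative_scaleR[OF Ck_on_Suc_has_derivative[OF Suc.prems(1)]
          Ck_on_Suc_has_derivative[OF Suc.prems(2)]]])
      (use Suc.prems in \<open>auto intro!: Ck_on_add assms(1) Suc.IH intro: Ck_on_SucD\<close>)
qed

text \<open>The derivative of \<open>1/f\<close> is a product of \<open>1/f\<close>, twice, with a
  derivative of \<open>f\<close>, so order \<open>k\<close> for \<open>1/f\<close> itself yields
  order \<open>Suc k\<close>.\<close>

lemma Ck_on_inverse:
  fixes f :: "'a::euclidean_space \<Rightarrow> real"
  assumes "open S" "Ck_on k S f" "\<And>x. x \<in> S \<Longrightarrow> f x \<noteq> 0"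
  shows "Ck_on k S (\<lambda>x. inverse (f x))"
  using assms(2)
proof (induction k)
  case 0
  then show ?case using assms(3) by (simp add: continuous_on_inverse)
next
  case (Suc k)
  have IH: "Ck_on k S (\<lambda>x. inverse (f x))" using Suc Ck_on_SucD by blast
  have "Ck_on k S (\<lambda>x. - (inverse (f x) * frechet_derivative f (at x) d * inverse (f x)))" for d
    using Suc.prems
    by (intro Ck_on_linear[OF assms(1) bounded_linear_minus[OF bounded_linear_ident]]
        Ck_on_scaleR[where 'b = real, unfolded real_scaleR_def] assms(1) IH) auto
  moreover have "((\<lambda>x. inverse (f x)) has_derivative
      (\<lambda>d. - (inverse (f x) * frechet_derivative f (at x) d * inverse (f x)))) (at x)" if "x \<in> S" for x
    using Deriv.has_derivative_inverse[OF assms(3) Ck_on_Suc_has_derivative[OF Suc.prems]] that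
    by blast
  ultimately show ?case by (intro Ck_on_SucI[OF assms(1)])
qed

section \<open>The algebra of smooth maps\<close>

lemma smooth_on_subset: "smooth_on S f \<Longrightarrow> T \<subseteq> S \<Longrightarrow> smooth_on T f"
  by (auto simp: smooth_on_def intro: Ck_on_subset)

lemma smooth_on_const: "smooth_on S (\<lambda>x. c)"
  by (simp add: smooth_on_def Ck_on_const)

lemma smooth_on_linear:
  "open S \<Longrightarrow> bounded_linear F \<Longrightarrow> smooth_on S f \<Longrightarrow> smooth_on S (\<lambda>x. F (f x))"
  by (simp add: smooth_on_def Ck_on_linear)

lemma smooth_on_add:
  "open S \<Longrightarrow> smooth_on S f \<Longrightarrow> smooth_on S g \<Longrightarrow> smooth_on S (\<lambda>x. f x + g x)"
  by (simp add: smooth_on_def Ck_on_add)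

lemma smooth_on_scaleR:
  "open S \<Longrightarrow> smooth_on S f \<Longrightarrow> smooth_on S g \<Longrightarrow> smooth_on S (\<lambda>x. f x *\<^sub>R g x)"
  for f :: "'a::euclidean_space \<Rightarrow> real"
  by (simp add: smooth_on_def Ck_on_scaleR)

lemma smooth_on_mult:
  "open S \<Longrightarrow> smooth_on S f \<Longrightarrow> smooth_on S g \<Longrightarrow> smooth_on S (\<lambda>x. f x * g x)"
  for f :: "'a::euclidean_space \<Rightarrow> real"
  using smooth_on_scaleR[of S f g] by simp

lemma smooth_on_diff:
  assumes "open S" "smooth_on S f" "smooth_on S g"
  shows "smooth_on S (\<lambda>x. f x - g x)"
  using smooth_on_add[OF assms(1,2) smooth_on_linear[OF assms(1)
        bounded_linear_minus[OF bounded_linear_ident] assms(3)]]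
  by simp

lemma smooth_on_divide:
  fixes f :: "'a::euclidean_space \<Rightarrow> real"
  assumes "open S" "smooth_on S f" "smooth_on S g" "\<And>x. x \<in> S \<Longrightarrow> g x \<noteq> 0"
  shows "smooth_on S (\<lambda>x. f x / g x)"
  unfolding divide_inverse
  using assms by (intro smooth_on_mult) (simp_all add: smooth_on_def Ck_on_inverse)

lemma smooth_on_sum:
  assumes "open S" "finite I" "\<And>i. i \<in> I \<Longrightarrow> smooth_on S (f i)"
  shows "smooth_on S (\<lambda>x. \<Sum>i\<in>I. f i x)"
  using assms(2,3) by (induction I) (simp_all add: smooth_on_const smooth_on_add assms(1))

lemma smooth_on_prod:
  fixes f :: "'i \<Rightarrow> 'a::euclidean_space \<Rightarrow> real"
  assumes "open S" "finite I" "\<And>i. i \<in> I \<Longrightarrow> smooth_on S (f i)"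
  shows "smooth_on S (\<lambda>x. \<Prod>i\<in>I. f i x)"
  using assms(2,3) by (induction I) (simp_all add: smooth_on_const smooth_on_mult assms(1))

lemma smooth_on_det:
  fixes M :: "'a::euclidean_space \<Rightarrow> real ^ 'n ^ 'n"
  assumes "open S" "\<And>i j. smooth_on S (\<lambda>x. M x $ i $ j)"
  shows "smooth_on S (\<lambda>x. det (M x))"
  unfolding det_def
  by (intro smooth_on_sum smooth_on_mult smooth_on_const smooth_on_prod assms)
    (simp_all add: finite_permutations)

lemma smooth_on_frechet_derivative:
  "smooth_on S f \<Longrightarrow> smooth_on S (\<lambda>x. frechet_derivative f (at x) d)"
  by (metis Ck_on.simps(2) smooth_on_def)

lemma smooth_on_has_derivative:
  "smooth_on S f \<Longrightarrow> x \<in> S \<Longrightarrow> (f has_derivative frechet_derivative f (at x)) (at x)"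
  using Ck_on_Suc_has_derivative smooth_on_def by blast

lemma smooth_on_nth:
  "open S \<Longrightarrow> smooth_on S f \<Longrightarrow> smooth_on S (\<lambda>x. f x $ i)"
  for f :: "'a::euclidean_space \<Rightarrow> real ^ 'n"
  by (rule smooth_on_linear[OF _ bounded_linear_vec_nth])

section \<open>Smooth local inverses\<close>

lemma linear_eq_sum_axis:
  fixes F :: "real ^ 'n \<Rightarrow> real"
  assumes "linear F"
  shows "F w = (\<Sum>k\<in>UNIV. w $ k * F (axis k 1))"
proof -
  have "F w = F (\<Sum>k\<in>UNIV. w $ k *\<^sub>R axis k 1)"
    by (simp add: basis_expansion[of w, unfolded scalar_mult_eq_scaleR])
  then show ?thesis by (simp add: linear_sum[OF assms] linear_scale[OF assms])
qed

text \<open>By Cramer's rule the derivative of \<open>g \<circ> \<psi>\<close> in a fixed direction is again of the form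
  \<open>G \<circ> \<psi>\<close> with \<open>G\<close> smooth, which closes the induction on the order of differentiability.\<close>

lemma smooth_on_compose_local_inverse:
  fixes u \<psi> :: "real ^ 'n \<Rightarrow> real ^ 'n" and g :: "real ^ 'n \<Rightarrow> real"
  assumes "open V" "open W" "smooth_on V u" "\<psi> ` W \<subseteq> V"
    and \<psi>': "\<And>y. y \<in> W \<Longrightarrow> (\<psi> has_derivative \<psi>' y) (at y)"
    and inv: "\<And>y d. y \<in> W \<Longrightarrow> frechet_derivative u (at (\<psi> y)) (\<psi>' y d) = d"
    and inj: "\<And>v. v \<in> V \<Longrightarrow> inj (frechet_derivative u (at v))"
    and "smooth_on V g"
  shows "smooth_on W (\<lambda>y. g (\<psi> y))"
proof -
  define M where "M v = matrix (frechet_derivative u (at v))" for v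
  \<comment> \<open>\<open>m d v\<close> solves \<open>M v *v x = d\<close>. As a quotient of
    determinants of smooth entries it is visibly smooth in \<open>v\<close>, and it will be
    identified with \<open>\<psi>' y d\<close> at \<open>v = \<psi> y\<close>.\<close>
  define m where
    "m d v = (\<chi> k. det (\<chi> i j. if j = k then d $ i else M v $ i $ j) / det (M v))" for d v
  have lin: "linear (frechet_derivative u (at v))" if "v \<in> V" for v
    using smooth_on_has_derivative[OF assms(3) that] has_derivative_linear by blast
  have M: "M v *v x = frechet_derivative u (at v) x" if "v \<in> V" for v x
    using lin[OF that] by (simp add: M_def)
  have det: "det (M v) \<noteq> 0" if "v \<in> V" for v
    using inj[OF that] lin[OF that] by (simp add: M_def det_nz_iff_inj)
  have smM: "smooth_on V (\<lambda>v. M v $ i $ j)" for i j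
    unfolding M_def matrix_def
    by (simp add: smooth_on_nth smooth_on_frechet_derivative assms(1,3))
  have "smooth_on V (\<lambda>v. if j = k then d $ i else M v $ i $ j)" for i j k d
    by (cases "j = k") (simp_all add: smooth_on_const smM)
  then have sm_m: "smooth_on V (\<lambda>v. m d v $ k)" for d k
    unfolding m_def vec_lambda_beta
    by (intro smooth_on_divide assms(1) smooth_on_det det smM) simp_all
  have \<psi>'_eq: "\<psi>' y d = m d (\<psi> y)" if "y \<in> W" for y d
  proof -
    have v: "\<psi> y \<in> V" using that assms(4) by blast
    have "M (\<psi> y) *v \<psi>' y d = d" using M[OF v] inv[OF that] by simp
    then show ?thesis unfolding m_def using cramer[OF det[OF v]] by blast
  qed
  have "Ck_on k W (\<lambda>y. g (\<psi> y))" if "smooth_on V g" for k and g :: "real ^ 'n \<Rightarrow> real"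
    using that
  proof (induction k arbitrary: g)
    case 0
    have "continuous_on W \<psi>"
      by (rule has_derivative_continuous_on[OF has_derivative_at_withinI[OF \<psi>']])
    moreover have "continuous_on V g"
      using 0 by (metis Ck_on.simps(1) smooth_on_def)
    ultimately show ?case using assms(4) by (auto intro: continuous_on_compose2)
  next
    case (Suc k)
    define G where
      "G d v = (\<Sum>i\<in>UNIV. m d v $ i * frechet_derivative g (at v) (axis i 1))" for d v
    have G: "smooth_on V (G d)" for d
      unfolding G_def
      by (intro smooth_on_sum smooth_on_mult smooth_on_frechet_derivative sm_m assms(1) Suc.prems)
        simp
    have "((\<lambda>y. g (\<psi> y)) has_derivative (\<lambda>d. G d (\<psi> y))) (at y)" if "y \<in> W" for y
    proof -
      have g': "(g has_derivative frechet_derivative g (at (\<psi> y))) (at (\<psi> y))"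
        using Suc.prems that assms(4) by (auto intro: smooth_on_has_derivative)
      have "G d (\<psi> y) = frechet_derivative g (at (\<psi> y)) (\<psi>' y d)" for d
        by (subst linear_eq_sum_axis) (use g' has_derivative_linear in \<open>auto simp: G_def \<psi>'_eq that\<close>)
      with has_derivative_compose[OF \<psi>'[OF that] g'] show ?thesis by simp
    qed
    then show ?case by (rule Ck_on_SucI[OF assms(2)]) (use Suc.IH G in auto)
  qed
  then show ?thesis using assms(8) by (simp add: smooth_on_def)
qed

text \<open>The inverse function theorem supplies a differentiable inverse \<open>\<psi>\<close>
  near \<open>v\<close>. Its smoothness is recorded through scalar compositions
  \<open>g (\<psi> y)\<close>, the form in which the Hamiltonian density will be obtained.\<close>

lemma smooth_local_inverse:
  fixes u :: "real ^ 'n \<Rightarrow> real ^ 'n"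
  assumes "open V" "smooth_on V u" "v \<in> V" "inj (frechet_derivative u (at v))"
  obtains V' W \<psi> \<psi>' where "open V'" "v \<in> V'" "V' \<subseteq> V" "open W" "u ` V' = W" "\<psi> ` W \<subseteq> V'"
    "\<And>x. x \<in> V' \<Longrightarrow> \<psi> (u x) = x"
    "\<And>y. y \<in> W \<Longrightarrow> (\<psi> has_derivative \<psi>' y) (at y)"
    "\<And>y d. y \<in> W \<Longrightarrow> frechet_derivative u (at (\<psi> y)) (\<psi>' y d) = d"
    "\<And>g :: real ^ 'n \<Rightarrow> real. smooth_on V g \<Longrightarrow> smooth_on W (\<lambda>y. g (\<psi> y))"
proof -
  let ?D = "\<lambda>x. frechet_derivative u (at x)"
  have lin: "linear (?D x)" if "x \<in> V" for x
    using smooth_on_has_derivative[OF assms(2) that] has_derivative_linear by blast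
  have blin: "blinfun_apply (Blinfun (?D x)) = ?D x" if "x \<in> V" for x
    using lin[OF that] by (simp add: bounded_linear_Blinfun_apply linear_conv_bounded_linear)
  \<comment> \<open>The inverse function theorem wants the derivative continuous as an operator; in
    finite dimension it suffices to test it on each vector \<open>d\<close>.\<close>
  have cont: "continuous_on V (\<lambda>x. Blinfun (?D x))"
  proof (rule continuous_on_blinfun_componentwise)
    fix d :: "real ^ 'n"
    have "continuous_on V (\<lambda>x. ?D x d)"
      using smooth_on_frechet_derivative[OF assms(2)] by (metis Ck_on.simps(1) smooth_on_def)
    then show "continuous_on V (\<lambda>x. blinfun_apply (Blinfun (?D x)) d)"
      by (rule continuous_on_eq) (simp add: blin)
  qed
  obtain G where G: "linear G" "G \<circ> ?D v = id"
    using linear_injective_left_inverse[OF lin[OF assms(3)] assms(4)] by blast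
  have inv: "Blinfun G o\<^sub>L Blinfun (?D v) = id_blinfun"
  proof (rule blinfun_eqI)
    fix x
    have "blinfun_apply (Blinfun G) = G"
      using G(1) by (simp add: bounded_linear_Blinfun_apply linear_conv_bounded_linear)
    then show "blinfun_apply (Blinfun G o\<^sub>L Blinfun (?D v)) x = blinfun_apply id_blinfun x"
      using pointfree_idE[OF G(2)] by (simp add: blin[OF assms(3)])
  qed
  have der: "(u has_derivative blinfun_apply (Blinfun (?D x))) (at x)" if "x \<in> V" for x
    using smooth_on_has_derivative[OF assms(2) that] by (simp add: blin[OF that])
  show thesis
  proof (rule inverse_function_theorem[OF assms(1) der cont assms(3) inv])
    fix V' W \<psi> \<psi>'
    assume *: "open V'" "V' \<subseteq> V" "v \<in> V'" "open W" "u v \<in> W"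
      "homeomorphism V' W u \<psi>" "\<And>y. y \<in> W \<Longrightarrow> (\<psi> has_derivative \<psi>' y) (at y)"
      "\<And>y. y \<in> W \<Longrightarrow> \<psi>' y = inv (blinfun_apply (Blinfun (?D (\<psi> y))))"
      "\<And>y. y \<in> W \<Longrightarrow> bij (blinfun_apply (Blinfun (?D (\<psi> y))))"
    have \<psi>: "\<psi> ` W \<subseteq> V'" "u ` V' = W" "\<And>x. x \<in> V' \<Longrightarrow> \<psi> (u x) = x"
      using *(6) by (auto simp: homeomorphism_def)
    have bij: "bij (?D (\<psi> y))" and \<psi>': "\<psi>' y = inv (?D (\<psi> y))" if "y \<in> W" for y
    proof -
      have "\<psi> y \<in> V" using that \<psi>(1) *(2) by blast
      then show "bij (?D (\<psi> y))" "\<psi>' y = inv (?D (\<psi> y))"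
        using *(8,9)[OF that] by (simp_all add: blin)
    qed
    have right_inv: "?D (\<psi> y) (\<psi>' y d) = d" if "y \<in> W" for y d
      using bij[OF that] by (simp add: \<psi>'[OF that] bij_is_surj surj_f_inv_f)
    have inj: "inj (?D x)" if "x \<in> V'" for x
      using bij[of "u x"] \<psi>(2,3) that by (auto simp: bij_is_inj)
    have "smooth_on W (\<lambda>y. g (\<psi> y))" if "smooth_on V g" for g :: "real ^ 'n \<Rightarrow> real"
      by (rule smooth_on_compose_local_inverse[OF *(1,4) smooth_on_subset[OF assms(2) *(2)] \<psi>(1)
            *(7) right_inv inj smooth_on_subset[OF that *(2)]])
    then show thesis by (intro that[OF *(1,3,2,4) \<psi>(2,1,3) *(7) right_inv])
  qed
qed

section \<open>Normal form of the quadric\<close>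

text \<open>The quadric \<open>\<Sum>\<epsilon>\<^sup>i(X\<^sup>i)\<^sup>2 = 2 X\<^sup>0 X\<^sup>n\<^sup>+\<^sup>1 + 2 X\<^sup>n\<^sup>+\<^sup>2 X\<^sup>n\<^sup>+\<^sup>3\<close> contains the lines of every Hamiltonian
  system with signs \<open>\<epsilon>\<close>.\<close>

fun std_form :: "('n::finite \<Rightarrow> real) \<Rightarrow> 'n hcoords \<Rightarrow> 'n hcoords \<Rightarrow> real" where
  "std_form \<epsilon> (x0, x, a, m, l) (y0, y, b, k, t) =
     (\<Sum>i\<in>UNIV. \<epsilon> i * x $ i * y $ i) - (x0 * b + a * y0) - (m * t + l * k)"

lemma nondegenerate_formD:
  assumes "nondegenerate_form B"
  shows "bilinear B" "B x y = B y x" "(\<And>y. B x y = 0) \<Longrightarrow> x = 0"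
  using assms unfolding nondegenerate_form_def by blast+

section \<open>Nondegeneracy, pullbacks and dual vectors\<close>

lemma bilinear_std_form: "bilinear (std_form \<epsilon>)"
  by (auto simp: bilinear_def linear_iff algebra_simps sum.distrib sum_distrib_left)

text \<open>Pairing with the coordinate vectors recovers each coordinate up to a nonzero
  factor.\<close>

lemma nondegenerate_form_std_form:
  assumes "\<And>i. \<epsilon> i \<noteq> 0"
  shows "nondegenerate_form (std_form (\<epsilon> :: 'n::finite \<Rightarrow> real))"
  unfolding nondegenerate_form_def
proof (intro conjI allI impI bilinear_std_form)
  show "std_form \<epsilon> x y = std_form \<epsilon> y x" for x y
    by (cases x; cases y) (simp add: mult.commute mult.left_commute)
next
  fix X :: "'n hcoords"
  assume *: "\<forall>Y. std_form \<epsilon> X Y = 0"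
  obtain x0 x a m l where X: "X = (x0, x, a, m, l)" by (cases X)
  have "x $ i = 0" for i
    using *[rule_format, of "(0, axis i 1, 0, 0, 0)"] assms[of i]
    by (simp add: X axis_def if_distrib cong: if_cong)
  then have "x = 0" by (simp add: vec_eq_iff)
  then show "X = 0"
    using *[rule_format, of "(1, 0, 0, 0, 0)"] *[rule_format, of "(0, 0, 1, 0, 0)"]
      *[rule_format, of "(0, 0, 0, 1, 0)"] *[rule_format, of "(0, 0, 0, 0, 1)"]
    by (simp add: X zero_prod_def)
qed

lemma nondegenerate_form_comp:
  assumes "nondegenerate_form B" "linear A" "bij A"
  shows "nondegenerate_form (\<lambda>x y. B (A x) (A y))"
proof -
  have "bilinear (\<lambda>x y. B (A x) (A y))"
    using nondegenerate_formD(1)[OF assms(1)] linear_compose[OF assms(2), unfolded o_def]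
    unfolding bilinear_def by blast
  moreover have "x = 0" if *: "\<forall>y. B (A x) (A y) = 0" for x
  proof -
    have "\<forall>y. B (A x) y = 0" using * assms(3) by (metis bij_pointE)
    then have "A x = 0" using nondegenerate_formD(3)[OF assms(1)] by blast
    then show "x = 0" using assms(2,3) by (metis bij_is_inj injD linear_0)
  qed
  ultimately show ?thesis
    using nondegenerate_formD(2)[OF assms(1)] unfolding nondegenerate_form_def by blast
qed

text \<open>The map \<open>z\<close> to \<open>(B x z, B y z)\<close> is onto the plane: a vector
  \<open>(a, b)\<close> orthogonal to its range would put
  \<open>a *\<^sub>R x + b *\<^sub>R y\<close> in the radical of \<open>B\<close>, contradicting
  independence.\<close>

lemma nondegenerate_form_dual:
  assumes B: "nondegenerate_form B"
    and indep: "\<And>a b. a *\<^sub>R x + b *\<^sub>R y = 0 \<Longrightarrow> a = 0 \<and> b = 0"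
  obtains z where "B x z = \<alpha>" "B y z = \<beta>"
proof -
  note bil = nondegenerate_formD(1)[OF B]
  define T where "T z = (B x z, B y z)" for z
  have T: "linear T"
    using bil by (simp add: T_def linear_iff bilinear_radd bilinear_rmul)
  have "range T = UNIV"
  proof (rule ccontr)
    assume "range T \<noteq> UNIV"
    then have "span (range T) \<noteq> UNIV"
      using T by (metis linear_subspace_image span_eq_iff subspace_UNIV)
    from span_not_UNIV_orthogonal[OF this]
    obtain c where "c \<noteq> 0" "\<forall>t \<in> span (range T). c \<bullet> t = 0" by blast
    moreover obtain a b where c: "c = (a, b)" by (cases c)
    ultimately have "a * B x z + b * B y z = 0" for z
      using span_base[of "T z" "range T"] by (auto simp: T_def)
    then have "a *\<^sub>R x + b *\<^sub>R y = 0"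
      using nondegenerate_formD(3)[OF B] bil by (simp add: bilinear_ladd bilinear_lmul)
    then show False using indep \<open>c \<noteq> 0\<close> c by (auto simp: zero_prod_def)
  qed
  then have "(\<alpha>, \<beta>) \<in> range T" by simp
  then show thesis using that by (auto simp: T_def)
qed

section \<open>Witt bases adapted to an isotropic plane\<close>

text \<open>If all vectors orthogonal to \<open>S\<close> were null, polarization would make them
  mutually orthogonal. Since \<open>proj\<close> splits every vector into a part in
  \<open>span S\<close> and one orthogonal to \<open>S\<close>, they would lie in the radical and
  vanish, so \<open>S\<close> would span a space of dimension \<open>CARD('n) + 4\<close> with too
  few elements. A vector that is not null is then rescaled.\<close>

lemma exists_orthogonal_unit_vector:
  fixes B :: "'n::finite hcoords \<Rightarrow> 'n hcoords \<Rightarrow> real"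
  assumes B: "nondegenerate_form B" and S: "finite S" "card S < CARD('n) + 4"
    and proj: "\<And>y. \<exists>s\<in>span S. \<forall>t\<in>S. B t (y - s) = 0"
  obtains z where "\<And>t. t \<in> S \<Longrightarrow> B t z = 0" "B z z = 1 \<or> B z z = -1"
proof -
  have bil: "bilinear B" and sym: "\<And>x y. B x y = B y x"
    using nondegenerate_formD[OF B] by blast+
  have lin: "linear (B x)" for x using bil unfolding bilinear_def by blast
  note bs = bilinear_ladd[OF bil] bilinear_radd[OF bil] bilinear_lmul[OF bil] bilinear_rmul[OF bil]
    bilinear_lsub[OF bil] bilinear_rsub[OF bil]
  have "\<exists>z. (\<forall>t\<in>S. B t z = 0) \<and> B z z \<noteq> 0"
  proof (rule ccontr)
    assume "\<not> ?thesis"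
    then have null: "B z z = 0" if "\<forall>t\<in>S. B t z = 0" for z using that by blast
    have zero: "z = 0" if z: "\<forall>t\<in>S. B t z = 0" for z
    proof -
      have z': "\<forall>t\<in>S. B z t = 0" using z sym by metis
      have "B z y = 0" for y
      proof -
        obtain s where s: "s \<in> span S" "\<forall>t\<in>S. B t (y - s) = 0" using proj by blast
        have "subspace {s. B z s = 0}" using lin by (rule linear_subspace_kernel)
        then have "B z s = 0"
          using span_minimal[of S "{s. B z s = 0}"] s(1) z' by auto
        moreover have "B (z + (y - s)) (z + (y - s)) = 0" by (rule null) (use z s in \<open>simp add: bs\<close>)
        then have "B z (y - s) = 0"
          using null[OF z] null[OF s(2)] sym[of z "y - s"] unfolding bs by linarith
        ultimately show ?thesis by (simp add: bs)
      qed
      then show ?thesis using nondegenerate_formD(3)[OF B] by blast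
    qed
    have "y \<in> span S" for y
      using proj[of y] zero[of "y - s" for s] by (metis eq_iff_diff_eq_0)
    then have "dim (UNIV :: 'n hcoords set) \<le> card S"
      by (intro dim_le_card S) auto
    then show False using S by simp
  qed
  then obtain z where z: "\<forall>t\<in>S. B t z = 0" "B z z \<noteq> 0" by blast
  define c where "c = 1 / sqrt \<bar>B z z\<bar>"
  have "c * c * \<bar>B z z\<bar> = 1" using z(2) by (simp add: c_def field_simps)
  then have "B (c *\<^sub>R z) (c *\<^sub>R z) = 1 \<or> B (c *\<^sub>R z) (c *\<^sub>R z) = -1"
    by (cases "B z z \<ge> 0") (simp_all add: bs)
  moreover have "B t (c *\<^sub>R z) = 0" if "t \<in> S" for t using z(1) that by (simp add: bs)
  ultimately show thesis using that by blast
qed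

text \<open>Completes the isotropic plane of \<open>x\<close> and \<open>y\<close> to two orthogonal
  hyperbolic planes. The pairing is -1, not 1, to match the sign of the mixed terms in
  \<open>std_form\<close>.\<close>

lemma hyperbolic_partners:
  assumes B: "nondegenerate_form B" and null: "B x x = 0" "B x y = 0" "B y y = 0"
    and indep: "\<And>a b. a *\<^sub>R x + b *\<^sub>R y = 0 \<Longrightarrow> a = 0 \<and> b = 0"
  obtains x1 y1 where "B x x1 = -1" "B y x1 = 0" "B x1 x1 = 0"
    "B x y1 = 0" "B y y1 = -1" "B x1 y1 = 0" "B y1 y1 = 0"
proof -
  have bil: "bilinear B" and sym: "\<And>x y. B x y = B y x"
    using nondegenerate_formD[OF B] by blast+
  note bs = bilinear_ladd[OF bil] bilinear_radd[OF bil] bilinear_lmul[OF bil] bilinear_rmul[OF bil]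
  obtain z where z: "B x z = -1" "B y z = 0"
    using nondegenerate_form_dual[OF B indep] by metis
  \<comment> \<open>As \<open>B x z = -1\<close>, adding \<open>c *\<^sub>R x\<close> lowers
    \<open>B z z\<close> by \<open>2 * c\<close>; this \<open>c\<close> makes the vector null
    without changing its pairings with \<open>x\<close> and \<open>y\<close>.\<close>
  define x1 where "x1 = z + (B z z / 2) *\<^sub>R x"
  obtain z' where z': "B x z' = 0" "B y z' = -1"
    using nondegenerate_form_dual[OF B indep] by metis
  \<comment> \<open>The multiple of \<open>y\<close> makes \<open>z'\<close> null as before. The
    multiple of \<open>x\<close> cancels the pairing with \<open>x1\<close> and costs nothing
    elsewhere, \<open>x\<close> being null and orthogonal to \<open>y\<close> and
    \<open>z'\<close>.\<close>
  define y1 where "y1 = z' + (B z' z' / 2) *\<^sub>R y + B x1 z' *\<^sub>R x"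
  have x1: "B x x1 = -1" "B y x1 = 0" "B x1 x1 = 0"
    using z sym[of z x] sym[of y x] by (simp_all add: x1_def bs null)
  have y1: "B x y1 = 0" "B y y1 = -1" "B y1 y1 = 0"
    using z' sym[of z' x] sym[of z' y] sym[of y x] by (simp_all add: y1_def bs null)
  have "B x1 y1 = 0"
    using x1 sym[of x1 x] sym[of x1 y] by (simp add: y1_def bs)
  then show thesis using that x1 y1 by blast
qed

text \<open>Gram-Schmidt for an indefinite form, by induction on the index set: the vectors found so
  far always admit an explicit orthogonal projection, and together with the four hyperbolic vectors
  they are too few to fill the space.\<close>

lemma orthogonal_family_of_hyperbolic_planes:
  fixes B :: "'n::finite hcoords \<Rightarrow> 'n hcoords \<Rightarrow> real"
  assumes B: "nondegenerate_form B"
    and H: "B x x = 0" "B x y = 0" "B y y = 0"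
      "B x x1 = -1" "B y x1 = 0" "B x1 x1 = 0"
      "B x y1 = 0" "B y y1 = -1" "B x1 y1 = 0" "B y1 y1 = 0"
  obtains e :: "'n \<Rightarrow> 'n hcoords" where
    "\<And>i. B (e i) (e i) = 1 \<or> B (e i) (e i) = -1"
    "\<And>i j. i \<noteq> j \<Longrightarrow> B (e i) (e j) = 0"
    "\<And>i s. s \<in> {x, y, x1, y1} \<Longrightarrow> B s (e i) = 0"
proof -
  have bil: "bilinear B" and sym: "\<And>x y. B x y = B y x"
    using nondegenerate_formD[OF B] by blast+
  have lin: "linear (B x)" for x using bil unfolding bilinear_def by blast
  note bs = bilinear_ladd[OF bil] bilinear_radd[OF bil] bilinear_lmul[OF bil] bilinear_rmul[OF bil]
    bilinear_lsub[OF bil] bilinear_rsub[OF bil] linear_sum[OF lin]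
  note H' = H sym[of y x] sym[of x1 x] sym[of x1 y] sym[of y1 x] sym[of y1 y] sym[of y1 x1]
  have "\<exists>e :: 'n \<Rightarrow> 'n hcoords. (\<forall>i\<in>I. B (e i) (e i) = 1 \<or> B (e i) (e i) = -1) \<and>
      (\<forall>i\<in>I. \<forall>j\<in>I. i \<noteq> j \<longrightarrow> B (e i) (e j) = 0) \<and>
      (\<forall>i\<in>I. \<forall>s\<in>{x, y, x1, y1}. B s (e i) = 0)" for I
    using finite[of I]
  proof (induction I)
    case empty
    then show ?case by simp
  next
    case (insert k I)
    then obtain e :: "'n \<Rightarrow> 'n hcoords" where
      e1: "\<forall>i\<in>I. B (e i) (e i) = 1 \<or> B (e i) (e i) = -1" and
      e2: "\<forall>i\<in>I. \<forall>j\<in>I. i \<noteq> j \<longrightarrow> B (e i) (e j) = 0" and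
      e3: "\<forall>i\<in>I. \<forall>s\<in>{x, y, x1, y1}. B s (e i) = 0" by blast
    have e3': "\<forall>i\<in>I. \<forall>s\<in>{x, y, x1, y1}. B (e i) s = 0" using e3 sym by metis
    let ?S = "{x, y, x1, y1} \<union> e ` I"
    have "card I < CARD('n)"
      using insert.hyps by (metis UNIV_I finite psubset_card_mono psubsetI subset_UNIV)
    moreover have "card {x, y, x1, y1} \<le> 4"
      using card_length[of "[x, y, x1, y1]"] by simp
    ultimately have card: "card ?S < CARD('n) + 4"
      using card_Un_le[of "{x, y, x1, y1}" "e ` I"] card_image_le[OF finite[of I], of e] by linarith
    have proj: "\<exists>s\<in>span ?S. \<forall>t\<in>?S. B t (z - s) = 0" for z
    proof
      \<comment> \<open>Orthogonal projection of \<open>z\<close>. The factors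
        \<open>B (e i) (e i)\<close> are signs, hence their own inverses; in a hyperbolic plane the
        coefficient of a vector is minus the pairing of \<open>z\<close> with its partner, since
        partners pair to -1.\<close>
      let ?T = "\<Sum>i\<in>I. (B (e i) (e i) * B (e i) z) *\<^sub>R e i"
      let ?s = "?T - B x1 z *\<^sub>R x - B x z *\<^sub>R x1 - B y1 z *\<^sub>R y - B y z *\<^sub>R y1"
      show "?s \<in> span ?S"
        by (intro span_diff span_scale span_sum) (auto intro: span_base)
      have "B t ?T = 0" if "t \<in> {x, y, x1, y1}" for t
        using e3 that by (auto simp: bs intro!: sum.neutral)
      moreover have "B (e j) ?T = B (e j) z" if "j \<in> I" for j
      proof -
        have "B (e j) ?T = (\<Sum>i\<in>I. if i = j then B (e j) z else 0)"
          unfolding bs by (rule sum.cong) (use e1 e2 that in auto)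
        then show ?thesis using that by simp
      qed
      ultimately show "\<forall>t\<in>?S. B t (z - ?s) = 0"
        using e3' by (auto simp: bilinear_radd[OF bil] bilinear_rmul[OF bil]
            bilinear_rsub[OF bil] H')
    qed
    have "finite ?S" by simp
    from exists_orthogonal_unit_vector[OF B this card proj]
    obtain z where z: "\<And>t. t \<in> ?S \<Longrightarrow> B t z = 0" "B z z = 1 \<or> B z z = -1"
      by blast
    moreover have "\<And>t. t \<in> ?S \<Longrightarrow> B z t = 0" using z(1) sym by metis
    ultimately show ?case
      by (intro exI[of _ "e(k := z)"]) (use e1 e2 e3 insert.hyps in auto)
  qed
  from this[of UNIV] obtain e :: "'n \<Rightarrow> 'n hcoords" where
    e1: "\<forall>i\<in>UNIV. B (e i) (e i) = 1 \<or> B (e i) (e i) = -1" and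
    e2: "\<forall>i\<in>UNIV. \<forall>j\<in>UNIV. i \<noteq> j \<longrightarrow> B (e i) (e j) = 0" and
    e3: "\<forall>i\<in>UNIV. \<forall>s\<in>{x, y, x1, y1}. B s (e i) = 0"
    by (elim exE conjE)
  show thesis
    by (rule that[of e]) (use e1 e2 in simp, use e2 in simp, use e3 in blast)
qed

text \<open>The linear map \<open>C\<close> sends the coordinate vectors to a Witt basis containing
  \<open>x\<close> and \<open>y\<close>. It carries \<open>std_form \<epsilon>\<close> to
  \<open>B\<close>, so its kernel lies in the radical of \<open>std_form \<epsilon>\<close> and is
  zero; by dimension it is bijective, and \<open>A\<close> is its inverse.\<close>

lemma nondegenerate_form_normal_form:
  fixes B :: "'n::finite hcoords \<Rightarrow> 'n hcoords \<Rightarrow> real"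
  assumes B: "nondegenerate_form B" and null: "B x x = 0" "B x y = 0" "B y y = 0"
    and indep: "\<And>a b. a *\<^sub>R x + b *\<^sub>R y = 0 \<Longrightarrow> a = 0 \<and> b = 0"
  obtains \<epsilon> :: "'n \<Rightarrow> real" and A :: "'n hcoords \<Rightarrow> 'n hcoords" where "\<And>i. \<epsilon> i = 1 \<or> \<epsilon> i = -1" "linear A" "bij A"
    "A x = (1, 0, 0, 0, 0)" "A y = (0, 0, 0, 0, 1)"
    "\<And>z w. B z w = std_form \<epsilon> (A z) (A w)"
proof -
  have bil: "bilinear B" and sym: "\<And>x y. B x y = B y x"
    using nondegenerate_formD[OF B] by blast+
  have lin: "linear (B x)" "linear (\<lambda>x. B x y)" for x y using bil unfolding bilinear_def by blast+
  note bs = bilinear_ladd[OF bil] bilinear_radd[OF bil] bilinear_lmul[OF bil] bilinear_rmul[OF bil]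
    linear_sum[OF lin(1)] linear_sum[OF lin(2)]
  obtain x1 y1 where H: "B x x1 = -1" "B y x1 = 0" "B x1 x1 = 0"
    "B x y1 = 0" "B y y1 = -1" "B x1 y1 = 0" "B y1 y1 = 0"
    using hyperbolic_partners[OF B null indep] by metis
  obtain e :: "'n \<Rightarrow> 'n hcoords" where e: "\<And>i. B (e i) (e i) = 1 \<or> B (e i) (e i) = -1"
    "\<And>i j. i \<noteq> j \<Longrightarrow> B (e i) (e j) = 0" "\<And>i s. s \<in> {x, y, x1, y1} \<Longrightarrow> B s (e i) = 0"
    using orthogonal_family_of_hyperbolic_planes[OF B null H] by metis
  note e' = e(3)[of x] e(3)[of y] e(3)[of x1] e(3)[of y1]
  define \<epsilon> where "\<epsilon> i = B (e i) (e i)" for i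
  have ee: "B (e i) (e j) = (if j = i then \<epsilon> i else 0)" for i j
    using e(2) by (simp add: \<epsilon>_def)
  \<comment> \<open>Partners occupy the slots that \<open>std_form\<close> pairs: \<open>x\<close>
    with \<open>x1\<close> in the first and third, \<open>y1\<close> with \<open>y\<close> in the
    fourth and fifth.\<close>
  define C :: "'n hcoords \<Rightarrow> 'n hcoords" where
    "C = (\<lambda>(c, v, a, m, l). c *\<^sub>R x + (\<Sum>i\<in>UNIV. v $ i *\<^sub>R e i) + a *\<^sub>R x1 + m *\<^sub>R y1 + l *\<^sub>R y)"
  have C: "linear C"
    by (auto simp: C_def linear_iff algebra_simps sum.distrib scaleR_sum_right)
  have iso: "B (C z) (C w) = std_form \<epsilon> z w" for z w
  proof -
    obtain c v a m l where z: "z = (c, v, a, m, l)" by (cases z)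
    obtain c' v' a' m' l' where w: "w = (c', v', a', m', l')" by (cases w)
    have "B (\<Sum>i\<in>UNIV. v $ i *\<^sub>R e i) (\<Sum>i\<in>UNIV. v' $ i *\<^sub>R e i) = (\<Sum>i\<in>UNIV. \<epsilon> i * v $ i * v' $ i)"
      by (simp add: bs ee if_distrib algebra_simps cong: if_cong)
    moreover have "B s (\<Sum>i\<in>UNIV. v $ i *\<^sub>R e i) = 0" "B (\<Sum>i\<in>UNIV. v $ i *\<^sub>R e i) s = 0"
      if "s \<in> {x, y, x1, y1}" for s v
      using e(3)[OF that] sym[of "e i" s for i] by (simp_all add: bs)
    ultimately show ?thesis
      unfolding z w C_def
      by (simp add: bilinear_ladd[OF bil] bilinear_radd[OF bil] bilinear_lmul[OF bil]
          bilinear_rmul[OF bil] null H sym[of y x] sym[of x1 x] sym[of y1 x] sym[of x1 y]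
          sym[of y1 y] sym[of y1 x1] algebra_simps)
  qed
  have "\<epsilon> i \<noteq> 0" for i using e(1)[of i] by (auto simp: \<epsilon>_def)
  note nd = nondegenerate_form_std_form[of \<epsilon>, OF this]
  have "z = 0" if "C z = 0" for z
    using nondegenerate_formD(3)[OF nd, of z] iso[of z] that by (simp add: bilinear_lzero[OF bil])
  then have inj: "inj C" using C by (simp add: linear_injective_0)
  then have bij: "bij C" using C linear_injective_imp_surjective by (auto simp: bij_def)
  show thesis
  proof (rule that[of \<epsilon> "inv C"])
    show "\<epsilon> i = 1 \<or> \<epsilon> i = -1" for i using e(1) by (simp add: \<epsilon>_def)
    show "bij (inv C)" using bij by (rule bij_imp_bij_inv)
    show "linear (inv C)" using C inj by (rule inj_linear_imp_inv_linear)
    have "C (1, 0, 0, 0, 0) = x" "C (0, 0, 0, 0, 1) = y" by (simp_all add: C_def)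
    then show "inv C x = (1, 0, 0, 0, 0)" "inv C y = (0, 0, 0, 0, 1)"
      by (simp_all add: inv_f_eq[OF inj])
    show "B z w = std_form \<epsilon> (inv C z) (inv C w)" for z w
      using iso[of "inv C z" "inv C w"] bij by (simp add: bij_is_surj surj_f_inv_f)
  qed
qed

section \<open>Frames of line families\<close>

lemma span_pair_iff: "z \<in> span {x, y} \<longleftrightarrow> (\<exists>a b. z = a *\<^sub>R x + b *\<^sub>R y)"
  by (simp add: span_insert span_singleton image_iff) (metis add.commute diff_add_cancel add_diff_cancel_left')

text \<open>A nontrivial relation would put one generator into the span of the other, leaving
  dimension at most 1.\<close>

lemma line_basis_independent:
  assumes "is_line (span {x, y})" "a *\<^sub>R x + b *\<^sub>R y = 0"
  shows "a = 0 \<and> b = 0"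
proof (rule ccontr)
  assume *: "\<not> ?thesis"
  obtain z where "span {x, y} \<subseteq> span {z}"
  proof (cases "a = 0")
    case True
    then have "y \<in> span {x}" using * assms(2) by (simp add: span_zero)
    then show thesis using that[of x] by (simp add: span_minimal span_base)
  next
    case False
    have eq: "a *\<^sub>R x = (- b) *\<^sub>R y" using assms(2) by (simp add: eq_neg_iff_add_eq_0)
    have "x = (1 / a) *\<^sub>R (a *\<^sub>R x)" using False by simp
    also have "\<dots> = (- b / a) *\<^sub>R y" unfolding eq by simp
    finally have "x \<in> span {y}" by (simp only:) (intro span_scale span_base, simp)
    then show thesis using that[of y] by (simp add: span_minimal span_base)
  qed
  then have "dim (span {x, y}) \<le> card {z}" by (intro dim_le_card) simp_all
  then show False using assms(1) by (simp add: is_line_def)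
qed

lemma line_basis_extension:
  assumes "is_line \<Lambda>" "x \<in> \<Lambda>" "x \<noteq> 0"
  obtains y where "\<Lambda> = span {x, y}"
proof -
  have sub: "subspace \<Lambda>" and dim: "dim \<Lambda> = 2" using assms(1) by (simp_all add: is_line_def)
  have "\<not> \<Lambda> \<subseteq> span {x}" using dim_le_card[of \<Lambda> "{x}"] dim by auto
  then obtain y where y: "y \<in> \<Lambda>" "y \<notin> span {x}" by blast
  have "independent {y, x}" using y(2) assms(3) by (simp add: independent_insert)
  moreover have "y \<noteq> x" using y(2) by (auto intro: span_base)
  ultimately have "dim (span {x, y}) = 2"
    using dim_eq_card_independent[of "{y, x}"] by (simp add: insert_commute)
  moreover have "span {x, y} \<subseteq> \<Lambda>" using sub y(1) assms(2) by (intro span_minimal) simp_all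
  ultimately have "span {x, y} = \<Lambda>" using dim sub by (intro subspace_dim_equal) simp_all
  then show thesis using that by blast
qed

text \<open>With \<open>f\<close> and \<open>g\<close> fixed, such a frame is unique, and a section \<open>Z\<close> of \<open>L\<close> has the coefficients
  \<open>f (Z v)\<close> and \<open>g (Z v)\<close> in it.\<close>

definition dual_frame ::
    "('n::finite hcoords \<Rightarrow> real) \<Rightarrow> ('n hcoords \<Rightarrow> real) \<Rightarrow> 'n line_family \<Rightarrow> (real ^ 'n) set \<Rightarrow>
     (real ^ 'n \<Rightarrow> 'n hcoords) \<Rightarrow> (real ^ 'n \<Rightarrow> 'n hcoords) \<Rightarrow> bool" where
  "dual_frame f g L V P R \<longleftrightarrow> linear f \<and> linear g \<and> local_frame L V P R \<and>
     (\<forall>v\<in>V. f (P v) = 1 \<and> g (P v) = 0 \<and> f (R v) = 0 \<and> g (R v) = 1)"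

section \<open>Local frames dual to two linear functionals\<close>

lemma local_frame_subset: "local_frame L V X Y \<Longrightarrow> open V' \<Longrightarrow> V' \<subseteq> V \<Longrightarrow> local_frame L V' X Y"
  by (auto simp: local_frame_def intro: smooth_on_subset)

lemma dual_frame_subset: "dual_frame f g L V P R \<Longrightarrow> open V' \<Longrightarrow> V' \<subseteq> V \<Longrightarrow> dual_frame f g L V' P R"
  by (auto simp: dual_frame_def intro: local_frame_subset)

text \<open>Inverts the 2 by 2 matrix of the values of \<open>f\<close> and \<open>g\<close> on a
  given frame. Its determinant \<open>D\<close> is nonzero at \<open>v\<close> because
  \<open>f\<close> and \<open>g\<close> have no common zero on the line, hence nonzero on a
  neighbourhood.\<close>

lemma exists_dual_frame:
  assumes fr: "local_frame L V X Y" and lin: "linear f" "linear g" and v: "v \<in> V"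
    and inj: "\<And>z. z \<in> L v \<Longrightarrow> f z = 0 \<Longrightarrow> g z = 0 \<Longrightarrow> z = 0"
  obtains V' P R where "v \<in> V'" "V' \<subseteq> V" "dual_frame f g L V' P R"
proof -
  have opV: "open V" and smX: "smooth_on V X" and smY: "smooth_on V Y"
    and line: "\<And>z. z \<in> V \<Longrightarrow> is_line (L z)" and L: "\<And>z. z \<in> V \<Longrightarrow> L z = span {X z, Y z}"
    using fr by (auto simp: local_frame_def)
  have bl: "bounded_linear f" "bounded_linear g" using lin by (simp_all add: linear_conv_bounded_linear)
  define D where "D z = f (X z) * g (Y z) - f (Y z) * g (X z)" for z
  have sm: "smooth_on V (\<lambda>z. f (X z))" "smooth_on V (\<lambda>z. f (Y z))"
    "smooth_on V (\<lambda>z. g (X z))" "smooth_on V (\<lambda>z. g (Y z))"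
    by (rule smooth_on_linear[OF opV bl(1) smX] smooth_on_linear[OF opV bl(1) smY]
        smooth_on_linear[OF opV bl(2) smX] smooth_on_linear[OF opV bl(2) smY])+
  have smD: "smooth_on V D"
    unfolding D_def by (intro smooth_on_diff smooth_on_mult opV sm)
  define V' where "V' = {z \<in> V. D z \<noteq> 0}"
  have "continuous_on V D" using smD by (metis Ck_on.simps(1) smooth_on_def)
  then have "open (V \<inter> D -` (- {0}))" using opV by (intro continuous_open_preimage) auto
  moreover have "V' = V \<inter> D -` (- {0})" by (auto simp: V'_def)
  ultimately have opV': "open V'" by simp
  have sub: "V' \<subseteq> V" by (auto simp: V'_def)
  \<comment> \<open>If \<open>D v = 0\<close>, two explicit combinations of \<open>X v\<close> and
    \<open>Y v\<close> are killed by both functionals and hence vanish. Independence makes all four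
    entries zero, and then \<open>X v\<close> itself is a common zero.\<close>
  have "D v \<noteq> 0"
  proof
    assume D: "D v = 0"
    have mem: "a *\<^sub>R X v + b *\<^sub>R Y v \<in> L v" for a b
      by (auto simp: L[OF v] span_pair_iff)
    have val: "f (a *\<^sub>R X v + b *\<^sub>R Y v) = a * f (X v) + b * f (Y v)"
      "g (a *\<^sub>R X v + b *\<^sub>R Y v) = a * g (X v) + b * g (Y v)" for a b
      using lin by (simp_all add: linear_add linear_scale)
    have ind: "a = 0 \<and> b = 0" if "a *\<^sub>R X v + b *\<^sub>R Y v = 0" for a b
      by (rule line_basis_independent[OF line[OF v, unfolded L[OF v]] that])
    have "g (Y v) *\<^sub>R X v + (- g (X v)) *\<^sub>R Y v = 0"
      by (rule inj[OF mem]) (use D in \<open>simp_all only: val\<close>, simp_all add: D_def algebra_simps)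
    from ind[OF this] have 1: "g (Y v) = 0" "g (X v) = 0" by simp_all
    have "f (Y v) *\<^sub>R X v + (- f (X v)) *\<^sub>R Y v = 0"
      by (rule inj[OF mem]) (simp_all only: val, simp_all add: 1)
    from ind[OF this] have 2: "f (Y v) = 0" "f (X v) = 0" by simp_all
    have "1 *\<^sub>R X v + 0 *\<^sub>R Y v = 0"
      by (rule inj[OF mem]) (simp_all only: val, simp_all add: 1 2)
    from ind[OF this] show False by simp
  qed
  then have v': "v \<in> V'" using v by (simp add: V'_def)
  define P where "P z = (g (Y z) / D z) *\<^sub>R X z - (g (X z) / D z) *\<^sub>R Y z" for z
  define R where "R z = (f (X z) / D z) *\<^sub>R Y z - (f (Y z) / D z) *\<^sub>R X z" for z
  note sm' = smooth_on_subset[OF _ sub]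
  have smP: "smooth_on V' P" and smR: "smooth_on V' R"
    unfolding P_def R_def
    by (intro smooth_on_diff smooth_on_scaleR smooth_on_divide opV' sm'[OF smX] sm'[OF smY]
        sm'[OF smD] sm[THEN sm']; simp add: V'_def)+
  have dual: "f (P z) = 1 \<and> g (P z) = 0 \<and> f (R z) = 0 \<and> g (R z) = 1" if "z \<in> V'" for z
  proof -
    have "D z \<noteq> 0" using that by (simp add: V'_def)
    then show ?thesis
      using lin by (simp add: P_def R_def linear_diff linear_scale field_simps) (simp add: D_def)
  qed
  have span: "L z = span {P z, R z}" if z: "z \<in> V'" for z
  proof -
    have D: "D z \<noteq> 0" using z by (simp add: V'_def)
    have Xz: "X z = f (X z) *\<^sub>R P z + g (X z) *\<^sub>R R z"
    proof -
      have "f (X z) *\<^sub>R P z + g (X z) *\<^sub>R R z =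
          ((f (X z) * g (Y z) - f (Y z) * g (X z)) / D z) *\<^sub>R X z"
        unfolding P_def R_def by (simp add: algebra_simps diff_divide_distrib)
      then show ?thesis using D unfolding D_def[symmetric] by simp
    qed
    have Yz: "Y z = f (Y z) *\<^sub>R P z + g (Y z) *\<^sub>R R z"
    proof -
      have "f (Y z) *\<^sub>R P z + g (Y z) *\<^sub>R R z =
          ((f (X z) * g (Y z) - f (Y z) * g (X z)) / D z) *\<^sub>R Y z"
        unfolding P_def R_def by (simp add: algebra_simps diff_divide_distrib)
      then show ?thesis using D unfolding D_def[symmetric] by simp
    qed
    have "{X z, Y z} \<subseteq> span {P z, R z}" using Xz Yz by (auto simp: span_pair_iff)
    moreover have "{P z, R z} \<subseteq> span {X z, Y z}"
      unfolding P_def R_def by (simp add: span_diff span_scale span_base)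
    ultimately have "span {X z, Y z} = span {P z, R z}"
      by (meson span_minimal subspace_span subset_antisym)
    then show ?thesis using L z sub by auto
  qed
  have "local_frame L V' P R"
    unfolding local_frame_def using opV' smP smR span line sub by blast
  then have "dual_frame f g L V' P R" using lin dual by (simp add: dual_frame_def)
  then show thesis using that v' sub by blast
qed

lemma dual_frame_expand:
  assumes "dual_frame f g L V P R" "v \<in> V" "z \<in> L v"
  shows "z = f z *\<^sub>R P v + g z *\<^sub>R R v"
proof -
  have *: "linear f" "linear g" "L v = span {P v, R v}"
    "f (P v) = 1" "g (P v) = 0" "f (R v) = 0" "g (R v) = 1"
    using assms(1,2) by (auto simp: dual_frame_def local_frame_def)
  obtain a b where z: "z = a *\<^sub>R P v + b *\<^sub>R R v" using assms(3) * by (auto simp: span_pair_iff)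
  have "f z = a" "g z = b" using * by (simp_all add: z linear_add linear_scale)
  then show ?thesis using z by simp
qed

lemma dual_frame_has_derivative:
  assumes "dual_frame f g L V P R" "v \<in> V"
  shows "(P has_derivative frechet_derivative P (at v)) (at v)"
    "(R has_derivative frechet_derivative R (at v)) (at v)"
  using assms by (auto simp: dual_frame_def local_frame_def intro: smooth_on_has_derivative)

text \<open>Differentiate the expansion \<open>Z = f(Z) P + g(Z) R\<close>: the terms with
  differentiated coefficients stay in \<open>L v\<close>, so modulo the line only the derivatives of
  the frame matter.\<close>

lemma dual_frame_section_derivative:
  assumes fr: "dual_frame f g L V P R" and v: "v \<in> V"
    and Z: "(Z has_derivative Z') (at v)" and N: "open N" "v \<in> N" "\<And>z. z \<in> N \<Longrightarrow> Z z \<in> L z"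
  shows "f (Z v) *\<^sub>R frechet_derivative P (at v) w + g (Z v) *\<^sub>R frechet_derivative R (at v) w - Z' w
    \<in> L v"
proof -
  have lin: "linear f" "linear g" and "open V" and L: "L v = span {P v, R v}"
    using fr v by (auto simp: dual_frame_def local_frame_def)
  have bl: "bounded_linear f" "bounded_linear g" using lin by (simp_all add: linear_conv_bounded_linear)
  have "((\<lambda>z. f (Z z) *\<^sub>R P z + g (Z z) *\<^sub>R R z) has_derivative
      (\<lambda>w. (f (Z v) *\<^sub>R frechet_derivative P (at v) w + f (Z' w) *\<^sub>R P v) +
        (g (Z v) *\<^sub>R frechet_derivative R (at v) w + g (Z' w) *\<^sub>R R v))) (at v)"
    by (intro has_derivative_add has_derivative_scaleR bl[THEN bounded_linear.has_derivative] Z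
        dual_frame_has_derivative[OF fr v])
  moreover have "open (V \<inter> N)" "v \<in> V \<inter> N" using \<open>open V\<close> N v by auto
  ultimately have "(Z has_derivative
      (\<lambda>w. (f (Z v) *\<^sub>R frechet_derivative P (at v) w + f (Z' w) *\<^sub>R P v) +
        (g (Z v) *\<^sub>R frechet_derivative R (at v) w + g (Z' w) *\<^sub>R R v))) (at v)"
    by (rule has_derivative_transform_within_open)
      (use dual_frame_expand[OF fr _ N(3)] in auto)
  from has_derivative_unique[OF Z this]
  have "Z' w = (f (Z v) *\<^sub>R frechet_derivative P (at v) w + f (Z' w) *\<^sub>R P v) +
        (g (Z v) *\<^sub>R frechet_derivative R (at v) w + g (Z' w) *\<^sub>R R v)" by (rule fun_cong)
  then have "f (Z v) *\<^sub>R frechet_derivative P (at v) w + g (Z v) *\<^sub>R frechet_derivative R (at v) w - Z' w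
    = (- f (Z' w)) *\<^sub>R P v + (- g (Z' w)) *\<^sub>R R v"
    by (simp add: algebra_simps)
  then show ?thesis unfolding L span_pair_iff by blast
qed

text \<open>Exhibits an actual representative of the derivative of the family, so that conditions
  imposed on all elements of \<open>family_deriv\<close> can be evaluated on the frame.\<close>

lemma dual_frame_family_deriv:
  assumes fr: "dual_frame f g L V P R" and v: "v \<in> V"
  shows "(\<lambda>x. f x *\<^sub>R frechet_derivative P (at v) w + g x *\<^sub>R frechet_derivative R (at v) w)
    \<in> family_deriv L v w" (is "?\<phi> \<in> _")
proof -
  have "linear f" "linear g" using fr by (auto simp: dual_frame_def)
  then have "linear ?\<phi>"
    by (simp add: linear_iff algebra_simps)
  then show ?thesis
    unfolding family_deriv_def
    by (auto intro!: dual_frame_section_derivative[OF fr v] smooth_on_has_derivative)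
qed

text \<open>Both functionals are constant along \<open>P\<close> and along \<open>R\<close>, so the
  derivatives of the frame lie in their common kernel.\<close>

lemma dual_frame_derivative_coords:
  fixes L :: "'n::finite line_family"
  assumes fr: "dual_frame f g L V P R" and v: "v \<in> V"
  shows "f (frechet_derivative P (at v) w) = 0" "g (frechet_derivative P (at v) w) = 0"
    "f (frechet_derivative R (at v) w) = 0" "g (frechet_derivative R (at v) w) = 0"
proof -
  have lin: "linear f" "linear g" and "open V"
    and dual: "\<And>z. z \<in> V \<Longrightarrow> f (P z) = 1" "\<And>z. z \<in> V \<Longrightarrow> g (P z) = 0"
      "\<And>z. z \<in> V \<Longrightarrow> f (R z) = 0" "\<And>z. z \<in> V \<Longrightarrow> g (R z) = 1"
    using fr by (auto simp: dual_frame_def local_frame_def)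
  have *: "F (frechet_derivative Q (at v) w) = 0"
    if F: "linear F" and c: "\<And>z. z \<in> V \<Longrightarrow> F (Q z) = c"
      and Q: "(Q has_derivative frechet_derivative Q (at v)) (at v)"
    for F :: "'n hcoords \<Rightarrow> real" and Q :: "real ^ 'n \<Rightarrow> 'n hcoords" and c
  proof -
    have "((\<lambda>z. F (Q z)) has_derivative (\<lambda>w. F (frechet_derivative Q (at v) w))) (at v)"
      using F Q by (simp add: linear_conv_bounded_linear bounded_linear.has_derivative)
    moreover have "((\<lambda>z. F (Q z)) has_derivative (\<lambda>w. 0)) (at v)"
      by (rule has_derivative_transform_within_open[OF has_derivative_const[of c] \<open>open V\<close> v])
        (simp add: c)
    ultimately show ?thesis by (metis has_derivative_unique)
  qed
  show "f (frechet_derivative P (at v) w) = 0" "g (frechet_derivative P (at v) w) = 0"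
    "f (frechet_derivative R (at v) w) = 0" "g (frechet_derivative R (at v) w) = 0"
    using * lin dual dual_frame_has_derivative[OF fr v] by blast+
qed

section \<open>Immersion, isotropy and contact conditions on frames\<close>

text \<open>The derivative of \<open>sweep X Y\<close> sends \<open>(w, a, b)\<close> to the
  derivative of the section \<open>s X + t Y\<close> along \<open>w\<close> plus
  \<open>a X + b Y\<close>. Its injectivity therefore makes the derivative of the section injective
  modulo the line, and forces the point itself to be nonzero.\<close>

lemma ruled_hypersurface_immersion:
  fixes L :: "'n::finite line_family"
  assumes "ruled_hypersurface U L" "v \<in> U"
  obtains V X Y s t where "v \<in> V" "V \<subseteq> U" "local_frame L V X Y" "s *\<^sub>R X v + t *\<^sub>R Y v \<noteq> 0"
    "\<And>w. s *\<^sub>R frechet_derivative X (at v) w + t *\<^sub>R frechet_derivative Y (at v) w \<in> L v \<Longrightarrow> w = 0"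
proof -
  obtain V X Y s t where *: "v \<in> V" "V \<subseteq> U" "local_frame L V X Y"
    and inj: "inj (frechet_derivative (sweep X Y) (at (v, s, t)))"
    using assms unfolding ruled_hypersurface_def by blast
  let ?X = "frechet_derivative X (at v)" and ?Y = "frechet_derivative Y (at v)"
  have L: "L v = span {X v, Y v}" using * by (auto simp: local_frame_def)
  have X: "(X has_derivative ?X) (at v)" and Y: "(Y has_derivative ?Y) (at v)"
    using * by (auto simp: local_frame_def intro: smooth_on_has_derivative)
  have lin: "linear ?X" "linear ?Y" using X Y has_derivative_linear by blast+
  have fst: "((\<lambda>p. Q (fst p)) has_derivative (\<lambda>p. Q' (fst p))) (at (v, s, t))"
    if "(Q has_derivative Q') (at v)" for Q :: "real ^ 'n \<Rightarrow> 'n hcoords" and Q'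
    using has_derivative_compose[OF has_derivative_fst[OF has_derivative_ident], of Q Q' "(v, s, t)"]
      that by simp
  have der: "((\<lambda>p. fst (snd p) *\<^sub>R X (fst p) + snd (snd p) *\<^sub>R Y (fst p)) has_derivative
      (\<lambda>p. (s *\<^sub>R ?X (fst p) + fst (snd p) *\<^sub>R X v) + (t *\<^sub>R ?Y (fst p) + snd (snd p) *\<^sub>R Y v)))
      (at (v, s, t))"
    using fst[OF X] fst[OF Y] by (auto intro!: derivative_eq_intros)
  have sweep: "sweep X Y = (\<lambda>p. fst (snd p) *\<^sub>R X (fst p) + snd (snd p) *\<^sub>R Y (fst p))"
    by (auto simp: sweep_def)
  have D: "frechet_derivative (sweep X Y) (at (v, s, t)) =
      (\<lambda>p. (s *\<^sub>R ?X (fst p) + fst (snd p) *\<^sub>R X v) + (t *\<^sub>R ?Y (fst p) + snd (snd p) *\<^sub>R Y v))"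
    unfolding sweep by (rule frechet_derivative_at[OF der, symmetric])
  have inj0: "p = 0" if "(s *\<^sub>R ?X (fst p) + fst (snd p) *\<^sub>R X v) + (t *\<^sub>R ?Y (fst p) + snd (snd p) *\<^sub>R Y v) = 0"
    for p
    using injD[OF inj[unfolded D], of p 0] that lin by (simp add: linear_0)
  have "s *\<^sub>R X v + t *\<^sub>R Y v \<noteq> 0"
  proof
    assume *: "s *\<^sub>R X v + t *\<^sub>R Y v = 0"
    \<comment> \<open>The derivative along the radial direction \<open>(0, s, t)\<close> is the
      point itself. If that vanishes, so do \<open>s\<close> and \<open>t\<close>, and then every
      direction \<open>(w, 0, 0)\<close> is in the kernel.\<close>
    have "(0 :: real ^ 'n, s, t) = 0"
      by (rule inj0) (simp add: * linear_0[OF lin(1)] linear_0[OF lin(2)])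
    then have st: "s = 0" "t = 0" by (simp_all only: zero_prod_def prod.inject)
    have "(axis k 1 :: real ^ 'n, 0 :: real, 0 :: real) = 0" for k by (rule inj0) (simp add: st)
    then have "axis k 1 = (0 :: real ^ 'n)" for k by (simp only: zero_prod_def prod.inject)
    then show False by simp
  qed
  moreover have "w = 0" if w: "s *\<^sub>R ?X w + t *\<^sub>R ?Y w \<in> L v" for w
  proof -
    obtain a b where "s *\<^sub>R ?X w + t *\<^sub>R ?Y w = a *\<^sub>R X v + b *\<^sub>R Y v"
      using w[unfolded L span_pair_iff] by blast
    then have "(w, -a, -b) = 0" by (intro inj0) (simp add: algebra_simps)
    then show "w = 0" by (simp only: zero_prod_def prod.inject)
  qed
  ultimately show thesis using that * by blast
qed

text \<open>Polarization, applied to \<open>x\<close>, \<open>y\<close> and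
  \<open>x + y\<close>.\<close>

lemma isotropic_subspace:
  assumes "nondegenerate_form B" "subspace \<Lambda>" "\<Lambda> \<subseteq> quadric B" "x \<in> \<Lambda>" "y \<in> \<Lambda>"
  shows "B x y = 0"
proof -
  have "B (x + y) (x + y) = 0" "B x x = 0" "B y y = 0"
    using assms(2-5) subspace_add[OF assms(2,4,5)] by (auto simp: quadric_def)
  then show ?thesis
    using nondegenerate_formD(2)[OF assms(1), of y x]
    by (simp add: bilinear_ladd bilinear_radd nondegenerate_formD(1)[OF assms(1)])
qed

lemma bilinear_constant_derivative:
  fixes P R :: "'b::real_normed_vector \<Rightarrow> 'a::euclidean_space"
  assumes "bilinear B" "open V" "v \<in> V" "\<And>z. z \<in> V \<Longrightarrow> B (P z) (R z) = (0 :: real)"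
    and "(P has_derivative P') (at v)" "(R has_derivative R') (at v)"
  shows "B (P v) (R' w) + B (P' w) (R v) = 0"
proof -
  have "bounded_bilinear B" using assms(1) by (simp add: bilinear_conv_bounded_bilinear)
  from bounded_bilinear.FDERIV[OF this assms(5,6)]
  have "((\<lambda>z. B (P z) (R z)) has_derivative (\<lambda>w. B (P v) (R' w) + B (P' w) (R v))) (at v)" .
  moreover have "((\<lambda>z. B (P z) (R z)) has_derivative (\<lambda>w. 0)) (at v)"
    by (rule has_derivative_transform_within_open[OF has_derivative_const[of 0] assms(2,3)])
      (simp add: assms(4))
  ultimately show ?thesis by (metis has_derivative_unique)
qed

text \<open>Tangency makes the bilinear map \<open>B x (\<phi> y)\<close> alternating on the plane,
  whatever the basis. One vanishing off-diagonal value, possibly in another basis, then makes it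
  zero.\<close>

lemma contact_plane_imp:
  assumes B: "nondegenerate_form B" and \<phi>: "\<phi> \<in> contact_plane B \<Lambda>" and xy: "x \<in> \<Lambda>" "y \<in> \<Lambda>"
  shows "B x (\<phi> y) = 0"
proof -
  note bil = nondegenerate_formD(1)[OF B]
  note bs = bilinear_ladd[OF bil] bilinear_radd[OF bil] bilinear_lmul[OF bil] bilinear_rmul[OF bil]
  have lin: "linear \<phi>" using \<phi> by (simp add: contact_plane_def fano_tangent_def)
  note ls = linear_add[OF lin] linear_scale[OF lin]
  obtain X Y where XY: "\<Lambda> = span {X, Y}" "B X (\<phi> X) = 0" "B Y (\<phi> Y) = 0"
    "B X (\<phi> Y) + B Y (\<phi> X) = 0"
    using \<phi> unfolding contact_plane_def fano_tangent_def by blast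
  obtain X' Y' where XY': "\<Lambda> = span {X', Y'}" "B X' (\<phi> Y') = 0"
    using \<phi> unfolding contact_plane_def by blast
  have diag: "B z (\<phi> z) = 0" if z: "z \<in> \<Lambda>" for z
  proof -
    obtain a b where "z = a *\<^sub>R X + b *\<^sub>R Y" using z XY(1) by (auto simp: span_pair_iff)
    then have "B z (\<phi> z) = a * b * (B X (\<phi> Y) + B Y (\<phi> X))"
      using XY(2,3) by (simp add: bs ls algebra_simps)
    then show ?thesis using XY(4) by simp
  qed
  have mem: "X' \<in> \<Lambda>" "Y' \<in> \<Lambda>" "X' + Y' \<in> \<Lambda>" unfolding XY'(1) by (auto intro: span_base span_add)
  have "B Y' (\<phi> X') = 0"
    using diag[OF mem(1)] diag[OF mem(2)] diag[OF mem(3)] XY'(2) by (simp add: bs ls)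
  moreover obtain a b where "x = a *\<^sub>R X' + b *\<^sub>R Y'" using xy XY'(1) by (auto simp: span_pair_iff)
  moreover obtain c d where "y = c *\<^sub>R X' + d *\<^sub>R Y'" using xy XY'(1) by (auto simp: span_pair_iff)
  ultimately show ?thesis
    using diag[OF mem(1)] diag[OF mem(2)] XY'(2) by (simp add: bs ls)
qed

section \<open>Hamiltonian systems and Legendre submanifolds\<close>

abbreviation last_coord :: "'n::finite hcoords \<Rightarrow> real" where
  "last_coord x \<equiv> snd (snd (snd (snd x)))"

lemma linear_first_last_coord:
  assumes "linear A"
  shows "linear (\<lambda>x. fst (A x))" "linear (\<lambda>x. last_coord (A x))"
  by (rule linearI; simp add: linear_add[OF assms] linear_scale[OF assms])+

text \<open>The sums over \<open>i\<close> cancel against the remaining coordinates, once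
  \<open>\<epsilon> i * \<epsilon> i = 1\<close> turns pairings of the fluxes
  \<open>\<epsilon> i * partial_deriv h i u\<close> into plain expressions in the gradient.\<close>

lemma std_form_ham:
  assumes \<epsilon>: "\<And>i. \<epsilon> i = 1 \<or> \<epsilon> i = -1"
  shows "std_form \<epsilon> (ham_p \<epsilon> h u) (ham_p \<epsilon> h u) = 0"
    "std_form \<epsilon> (ham_p \<epsilon> h u) (ham_r \<epsilon> h u) = 0"
    "std_form \<epsilon> (ham_r \<epsilon> h u) (ham_r \<epsilon> h u) = 0"
proof -
  have \<epsilon>2: "\<epsilon> i * \<epsilon> i = 1" for i using \<epsilon>[of i] by auto
  have \<epsilon>2': "\<epsilon> i * (\<epsilon> i * x) = x" for i x using \<epsilon>2[of i] by (simp flip: mult.assoc)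
  show "std_form \<epsilon> (ham_p \<epsilon> h u) (ham_p \<epsilon> h u) = 0"
    by (simp add: ham_p_def sqnorm_def power2_eq_square mult.assoc)
  show "std_form \<epsilon> (ham_p \<epsilon> h u) (ham_r \<epsilon> h u) = 0"
    by (simp add: ham_p_def ham_r_def \<epsilon>2' mult.left_commute mult.commute)
  show "std_form \<epsilon> (ham_r \<epsilon> h u) (ham_r \<epsilon> h u) = 0"
    by (simp add: ham_r_def sqnorm_def grad_def power2_eq_square ac_simps \<epsilon>2')
qed

text \<open>First and last coordinates take the values 1, 0 on \<open>ham_p\<close> and 0, 1 on
  \<open>ham_r\<close>, and a line has only one basis with these values. Equality of lines thus
  becomes equality of frames.\<close>

lemma ham_line_dual_frame:
  assumes A: "linear A"
    and fr: "dual_frame (\<lambda>x. fst (A x)) (\<lambda>x. last_coord (A x)) L V P R"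
    and v: "v \<in> V" and L: "A ` L v = ham_line \<epsilon> h u"
  shows "A (P v) = ham_p \<epsilon> h u" "A (R v) = ham_r \<epsilon> h u"
proof -
  have "P v \<in> L v" "R v \<in> L v" and
    dual: "fst (A (P v)) = 1" "last_coord (A (P v)) = 0" "fst (A (R v)) = 0" "last_coord (A (R v)) = 1"
    using fr v by (auto simp: dual_frame_def local_frame_def span_base)
  then have mem: "A (P v) \<in> ham_line \<epsilon> h u" "A (R v) \<in> ham_line \<epsilon> h u" using L by auto
  have *: "X = fst X *\<^sub>R ham_p \<epsilon> h u + last_coord X *\<^sub>R ham_r \<epsilon> h u" if X: "X \<in> ham_line \<epsilon> h u" for X
  proof -
    obtain a b where "X = a *\<^sub>R ham_p \<epsilon> h u + b *\<^sub>R ham_r \<epsilon> h u"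
      using X unfolding ham_line_def span_pair_iff by blast
    then show ?thesis by (simp add: ham_p_def ham_r_def)
  qed
  show "A (P v) = ham_p \<epsilon> h u" "A (R v) = ham_r \<epsilon> h u"
    using *[OF mem(1)] *[OF mem(2)] unfolding dual by simp_all
qed

lemma ham_line_coords_inj:
  assumes A: "linear A" "inj A" and L: "A ` \<Lambda> = ham_line \<epsilon> h u"
    and z: "z \<in> \<Lambda>" "fst (A z) = 0" "last_coord (A z) = 0"
  shows "z = 0"
proof -
  have "A z \<in> ham_line \<epsilon> h u" using z(1) L by blast
  then obtain a b where ab: "A z = a *\<^sub>R ham_p \<epsilon> h u + b *\<^sub>R ham_r \<epsilon> h u"
    unfolding ham_line_def span_pair_iff by blast
  then have "a = 0" "b = 0" using z(2,3) by (simp_all add: ham_p_def ham_r_def)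
  then have "A z = 0" using ab by simp
  then show ?thesis using A by (metis injD linear_0)
qed

text \<open>The derivative of \<open>p(u)\<close> has coordinates 0, \<open>du\<close>, some value,
  \<open>dh(du)\<close>, 0, and pairing it with \<open>r\<close> leaves the sum of
  \<open>h_i du^i\<close> minus \<open>dh(du)\<close>. Differentiability of \<open>u\<close> is read
  off from \<open>Q\<close>, of which it is a coordinate.\<close>

lemma ham_contact:
  assumes \<epsilon>: "\<And>i. \<epsilon> i = 1 \<or> \<epsilon> i = -1" and h: "(h has_derivative h') (at (u v))"
    and N: "open N" "v \<in> N" and Q: "(Q has_derivative Q') (at v)"
    and Qu: "\<And>z. z \<in> N \<Longrightarrow> Q z = ham_p \<epsilon> h (u z)"
  shows "std_form \<epsilon> (Q' w) (ham_r \<epsilon> h (u v)) = 0"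
proof -
  have \<epsilon>2': "\<epsilon> i * (\<epsilon> i * x) = x" for i x using \<epsilon>[of i] by auto
  let ?u' = "\<lambda>w. fst (snd (Q' w))"
  have "((\<lambda>z. fst (snd (Q z))) has_derivative ?u') (at v)"
    using Q by (intro has_derivative_fst has_derivative_snd)
  then have u: "(u has_derivative ?u') (at v)"
    by (rule has_derivative_transform_within_open[OF _ N]) (simp add: Qu ham_p_def)
  have coord: "(\<lambda>w. F (Q' w)) = d"
    if "bounded_linear F" "((\<lambda>z. F (ham_p \<epsilon> h (u z))) has_derivative d) (at v)"
    for F :: "'a hcoords \<Rightarrow> real" and d
  proof (rule has_derivative_unique)
    show "((\<lambda>z. F (Q z)) has_derivative (\<lambda>w. F (Q' w))) (at v)"
      using that(1) Q by (rule bounded_linear.has_derivative)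
    show "((\<lambda>z. F (Q z)) has_derivative d) (at v)"
      by (rule has_derivative_transform_within_open[OF that(2) N]) (simp add: Qu)
  qed
  have c1: "fst (Q' w) = 0"
    using coord[of fst "\<lambda>w. 0"] by (simp add: bounded_linear_fst ham_p_def fun_eq_iff)
  have c5: "last_coord (Q' w) = 0"
    using coord[of last_coord "\<lambda>w. 0"]
    by (simp add: ham_p_def fun_eq_iff bounded_linear_snd_comp bounded_linear_snd)
  have c4: "fst (snd (snd (snd (Q' w)))) = h' (?u' w)"
    using coord[of "\<lambda>x. fst (snd (snd (snd x)))" "\<lambda>w. h' (?u' w)"] has_derivative_compose[OF u h]
    by (simp add: ham_p_def fun_eq_iff bounded_linear_snd_comp bounded_linear_fst_comp
        bounded_linear_snd)
  have h'_eq: "frechet_derivative h (at (u v)) = h'" using frechet_derivative_at[OF h] by simp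
  have "h' (?u' w) = (\<Sum>i\<in>UNIV. ?u' w $ i * partial_deriv h i (u v))"
    unfolding partial_deriv_def h'_eq by (rule linear_eq_sum_axis[OF has_derivative_linear[OF h]])
  moreover obtain x0 x a m l where Q': "Q' w = (x0, x, a, m, l)" by (cases "Q' w")
  ultimately show ?thesis
    using c1 c4 c5 by (simp add: ham_r_def mult.left_commute[of "x $ i" for i] \<epsilon>2' mult.assoc)
qed

section \<open>From Hamiltonian systems to Legendre submanifolds\<close>

text \<open>The quadric is the preimage under \<open>A\<close> of the normal form. Isotropy and
  contact follow from the formulas for \<open>p\<close> and \<open>r\<close>, and injectivity of the
  family derivative from the immersion condition.\<close>

lemma hamiltonian_ruled_imp_legendre:
  fixes L :: "'n::finite line_family"
  assumes ruled: "ruled_hypersurface U L" and V: "open V" "V \<subseteq> U" and ham: "hamiltonian_ruled V L"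
  shows "\<exists>B. nondegenerate_form B \<and> legendre_submanifold B V L"
proof -
  obtain \<epsilon> h W and A :: "'n hcoords \<Rightarrow> 'n hcoords" where "\<forall>i. \<epsilon> i = 1 \<or> \<epsilon> i = -1" and
    W: "open W" "smooth_on W h" and A: "linear A" "bij A" and
    img: "(\<lambda>v. A ` L v) ` V = ham_line \<epsilon> h ` W"
    using ham unfolding hamiltonian_ruled_def by (elim exE conjE)
  then have \<epsilon>: "\<epsilon> i = 1 \<or> \<epsilon> i = -1" for i by blast
  define B where "B = (\<lambda>x y. std_form \<epsilon> (A x) (A y))"
  have "\<epsilon> i \<noteq> 0" for i using \<epsilon>[of i] by auto
  then have B: "nondegenerate_form B"
    unfolding B_def by (rule nondegenerate_form_comp[OF nondegenerate_form_std_form A])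
  note bil = nondegenerate_formD(1)[OF B] and sym = nondegenerate_formD(2)[OF B]
  note bs = bilinear_ladd[OF bil] bilinear_radd[OF bil] bilinear_lmul[OF bil] bilinear_rmul[OF bil]
    bilinear_rsub[OF bil]
  let ?f = "\<lambda>x. fst (A x)" and ?g = "\<lambda>x. last_coord (A x)"
  have local: "\<exists>V1 X Y. v \<in> V1 \<and> V1 \<subseteq> V \<and> local_frame L V1 X Y" if v: "v \<in> V" for v
  proof -
    have "v \<in> U" using v V(2) by blast
    then show ?thesis
    proof (rule ruled_hypersurface_immersion[OF ruled])
      fix V1 X Y assume V1: "v \<in> V1" "local_frame L V1 X Y"
      then have "open (V1 \<inter> V)" using V(1) by (auto simp: local_frame_def)
      then have "local_frame L (V1 \<inter> V) X Y" by (rule local_frame_subset[OF V1(2)]) simp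
      then show ?thesis using v V1(1) by (intro exI[of _ "V1 \<inter> V"] exI[of _ X] exI[of _ Y]) simp
    qed
  qed
  have img': "\<exists>u\<in>W. A ` L z = ham_line \<epsilon> h u" if z: "z \<in> V" for z
  proof -
    have "A ` L z \<in> ham_line \<epsilon> h ` W" using imageI[OF z, of "\<lambda>v. A ` L v"] unfolding img .
    then show ?thesis by (elim imageE) (rule bexI)
  qed
  \<comment> \<open>The pairings of \<open>P\<close> and of \<open>R\<close> with their own
    derivatives vanish by differentiating \<open>(P, P) = 0\<close> and \<open>(R, R) = 0\<close>,
    that of \<open>R\<close> with \<open>dP\<close> by \<open>ham_contact\<close>, and that of
    \<open>P\<close> with \<open>dR\<close> by differentiating \<open>(P, R) = 0\<close>.\<close>
  have frame: "\<exists>N P R. v \<in> N \<and> N \<subseteq> V \<and> dual_frame ?f ?g L N P R \<and>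
      (\<forall>x\<in>L v. \<forall>y\<in>L v. B x y = 0) \<and>
      (\<forall>w. B (P v) (frechet_derivative P (at v) w) = 0 \<and>
        B (P v) (frechet_derivative R (at v) w) = 0 \<and>
        B (R v) (frechet_derivative P (at v) w) = 0 \<and>
        B (R v) (frechet_derivative R (at v) w) = 0)" if v: "v \<in> V" for v
  proof -
    obtain V1 X Y where V1: "v \<in> V1" "V1 \<subseteq> V" "local_frame L V1 X Y" using local[OF v] by blast
    obtain u0 where u0: "A ` L v = ham_line \<epsilon> h u0" using img'[OF v] by (elim bexE)
    have inj0: "z = 0" if "z \<in> L v" "fst (A z) = 0" "last_coord (A z) = 0" for z
      by (rule ham_line_coords_inj[OF A(1) bij_is_inj[OF A(2)] u0 that])
    obtain N P R where N: "v \<in> N" "N \<subseteq> V1" and fr: "dual_frame ?f ?g L N P R"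
      by (rule exists_dual_frame[OF V1(3) linear_first_last_coord[OF A(1)] V1(1) inj0])
    \<comment> \<open>The hypothesis equates only sets of lines; the parameter matching
      \<open>L z\<close> is recovered as the middle block of coordinates of
      \<open>P z\<close>.\<close>
    define u where "u z = fst (snd (A (P z)))" for z
    have PR: "A (P z) = ham_p \<epsilon> h (u z) \<and> A (R z) = ham_r \<epsilon> h (u z) \<and> u z \<in> W" if z: "z \<in> N" for z
    proof -
      have "z \<in> V" using z N V1(2) by blast
      from img'[OF this] obtain u' where u': "u' \<in> W" "A ` L z = ham_line \<epsilon> h u'" by (elim bexE)
      have "u z = u'" using ham_line_dual_frame(1)[OF A(1) fr z u'(2)] by (simp add: u_def ham_p_def)
      then show ?thesis using u' ham_line_dual_frame[OF A(1) fr z u'(2)] by simp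
    qed
    have null: "B (P z) (P z) = 0" "B (P z) (R z) = 0" "B (R z) (R z) = 0" if z: "z \<in> N" for z
      using PR[OF z] by (simp_all add: B_def std_form_ham[OF \<epsilon>])
    have openN: "open N" and Lv: "L v = span {P v, R v}"
      using fr N by (auto simp: dual_frame_def local_frame_def)
    let ?P = "frechet_derivative P (at v)" and ?R = "frechet_derivative R (at v)"
    note PR' = dual_frame_has_derivative[OF fr N(1)]
    note der = bilinear_constant_derivative[OF bil openN N(1)]
    have "B (P v) (?P w) = 0" for w
      using der[OF null(1) PR'(1) PR'(1), of w] sym[of "?P w" "P v"] by simp
    moreover have "B (R v) (?R w) = 0" for w
      using der[OF null(3) PR'(2) PR'(2), of w] sym[of "?R w" "R v"] by simp
    moreover have contact: "B (?P w) (R v) = 0" for w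
    proof -
      have dh: "(h has_derivative frechet_derivative h (at (u v))) (at (u v))"
        using PR[OF N(1)] W(2) by (intro smooth_on_has_derivative) auto
      have dP: "((\<lambda>z. A (P z)) has_derivative (\<lambda>w. A (?P w))) (at v)"
        using A(1) PR'(1) by (simp add: linear_conv_bounded_linear bounded_linear.has_derivative)
      have "std_form \<epsilon> (A (?P w)) (ham_r \<epsilon> h (u v)) = 0"
        by (rule ham_contact[where u = u, OF \<epsilon> dh openN N(1) dP]) (simp add: PR)
      then show ?thesis using PR[OF N(1)] by (simp add: B_def)
    qed
    moreover have "B (P v) (?R w) = 0" for w
      using der[OF null(2) PR'(1) PR'(2), of w] contact[of w] by simp
    moreover have "B x y = 0" if "x \<in> L v" "y \<in> L v" for x y
    proof -
      obtain a b where x: "x = a *\<^sub>R P v + b *\<^sub>R R v" using \<open>x \<in> L v\<close> unfolding Lv span_pair_iff by blast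
      obtain c d where y: "y = c *\<^sub>R P v + d *\<^sub>R R v" using \<open>y \<in> L v\<close> unfolding Lv span_pair_iff by blast
      show ?thesis
        unfolding x y bs by (simp add: null[OF N(1)] sym[of "R v" "P v"])
    qed
    ultimately show ?thesis
      using N V1(2) fr sym[of "R v"] by (intro exI[of _ N] exI[of _ P] exI[of _ R]) auto
  qed
  have line: "is_line (L v)" if v: "v \<in> V" for v
    using local[OF v] by (auto simp: local_frame_def)
  have "legendre_submanifold B V L"
    unfolding legendre_submanifold_def
  proof (intro conjI ballI allI impI subsetI)
    show "smooth_line_family V L"
      unfolding smooth_line_family_def using V(1) local by blast
    show "L v \<in> fano B" if "v \<in> V" for v
      using frame[OF that] line[OF that] by (auto simp: fano_def quadric_def)
  next
    fix v w \<phi> assume v: "v \<in> V" and \<phi>: "\<phi> \<in> family_deriv L v w" "\<phi> ` L v \<subseteq> L v"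
    have "v \<in> U" using v V(2) by blast
    then show "w = 0"
    proof (rule ruled_hypersurface_immersion[OF ruled])
      fix V1 X Y s t
      assume V1: "v \<in> V1" "local_frame L V1 X Y" and
        imm: "\<And>w. s *\<^sub>R frechet_derivative X (at v) w + t *\<^sub>R frechet_derivative Y (at v) w \<in> L v \<Longrightarrow> w = 0"
      have sub: "subspace (L v)" using line[OF v] by (simp add: is_line_def)
      have fr: "open V1" "smooth_on V1 X" "smooth_on V1 Y" "\<forall>z\<in>V1. X z \<in> L z" "\<forall>z\<in>V1. Y z \<in> L z"
        using V1 by (auto simp: local_frame_def span_base)
      \<comment> \<open>If \<open>\<phi>\<close> preserves \<open>L v\<close>, the derivatives of
        both frame sections along \<open>w\<close> lie in \<open>L v\<close>, which the immersion
        condition excludes unless \<open>w = 0\<close>.\<close>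
      have "Z' \<in> L v" if "\<phi> z - Z' \<in> L v" "z \<in> L v" for z Z'
        using subspace_diff[OF sub, of "\<phi> z" "\<phi> z - Z'"] that \<phi>(2) by auto
      then have "frechet_derivative X (at v) w \<in> L v" "frechet_derivative Y (at v) w \<in> L v"
        using \<phi>(1) fr V1(1) unfolding family_deriv_def by blast+
      then show "w = 0" by (intro imm subspace_add subspace_scale sub)
    qed
  next
    fix v w \<phi> assume v: "v \<in> V" and \<phi>: "\<phi> \<in> family_deriv L v w"
    obtain N P R where N: "v \<in> N" and fr: "dual_frame ?f ?g L N P R" and
      null: "\<And>x y. x \<in> L v \<Longrightarrow> y \<in> L v \<Longrightarrow> B x y = 0" and
      der: "B (P v) (frechet_derivative P (at v) w) = 0"
        "B (P v) (frechet_derivative R (at v) w) = 0"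
        "B (R v) (frechet_derivative P (at v) w) = 0"
        "B (R v) (frechet_derivative R (at v) w) = 0"
      using frame[OF v] by blast
    have sm: "open N" "smooth_on N P" "smooth_on N R" "\<forall>z\<in>N. P z \<in> L z" "\<forall>z\<in>N. R z \<in> L z"
      and Lv: "L v = span {P v, R v}"
      using fr N by (auto simp: dual_frame_def local_frame_def span_base)
    have lin: "linear \<phi>" and
      mem: "\<phi> (P v) - frechet_derivative P (at v) w \<in> L v" "\<phi> (R v) - frechet_derivative R (at v) w \<in> L v"
      using \<phi> sm N unfolding family_deriv_def by blast+
    have PR: "P v \<in> L v" "R v \<in> L v" using sm N by blast+
    \<comment> \<open>\<open>\<phi>\<close> differs from the derivative of the frame by elements of
      \<open>L v\<close>, and these are orthogonal to \<open>L v\<close>.\<close>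
    have "B (P v) (\<phi> (P v)) = 0" "B (R v) (\<phi> (P v)) = 0"
      using null[OF PR(1) mem(1)] null[OF PR(2) mem(1)] der by (simp_all add: bs)
    moreover have "B (P v) (\<phi> (R v)) = 0" "B (R v) (\<phi> (R v)) = 0"
      using null[OF PR(1) mem(2)] null[OF PR(2) mem(2)] der by (simp_all add: bs)
    ultimately show "\<phi> \<in> contact_plane B (L v)"
      unfolding contact_plane_def fano_tangent_def mem_Collect_eq
      by (intro conjI lin exI[of _ "P v"] exI[of _ "R v"] Lv) simp_all
  qed
  then show ?thesis using B by blast
qed

section \<open>From Legendre submanifolds to Hamiltonian systems\<close>

text \<open>The contact condition is evaluated on the representative built from the dual frame,
  which sends \<open>P v\<close> to the derivative of \<open>P\<close>.\<close>

lemma legendre_dual_frame: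
  assumes B: "nondegenerate_form B" and leg: "legendre_submanifold B V L"
    and fr: "dual_frame f g L N P R" and v: "v \<in> N" "v \<in> V"
  shows "B (P v) (P v) = 0" "B (P v) (R v) = 0" "B (R v) (R v) = 0"
    "B (frechet_derivative P (at v) w) (R v) = 0"
    "B (P v) (frechet_derivative P (at v) w) = 0"
proof -
  have Lv: "L v \<in> fano B" using leg v(2) unfolding legendre_submanifold_def by blast
  then have sub: "subspace (L v)" "L v \<subseteq> quadric B" by (simp_all add: fano_def is_line_def)
  have PR: "P v \<in> L v" "R v \<in> L v" and lin: "linear f" "linear g"
    and dual: "f (P v) = 1" "g (P v) = 0"
    using fr v(1) by (auto simp: dual_frame_def local_frame_def span_base)
  show "B (P v) (P v) = 0" "B (P v) (R v) = 0" "B (R v) (R v) = 0"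
    by (rule isotropic_subspace[OF B sub]; fact)+
  have "(\<lambda>x. f x *\<^sub>R frechet_derivative P (at v) w + g x *\<^sub>R frechet_derivative R (at v) w)
      \<in> contact_plane B (L v)"
    using dual_frame_family_deriv[OF fr v(1), of w] leg v(2) unfolding legendre_submanifold_def
    by blast
  from contact_plane_imp[OF B this PR(2) PR(1)] contact_plane_imp[OF B this PR(1) PR(1)]
  show "B (frechet_derivative P (at v) w) (R v) = 0" "B (P v) (frechet_derivative P (at v) w) = 0"
    using nondegenerate_formD(2)[OF B, of "R v"] by (simp_all add: dual)
qed

text \<open>The three isotropy equations are linear in the third coordinates of \<open>X\<close> and
  \<open>Y\<close> and the fourth of \<open>Y\<close>, and determine them from the data prescribed
  by \<open>h\<close>.\<close>

lemma ham_line_of_normal_frame: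
  fixes q :: "real ^ 'n::finite"
  assumes \<epsilon>: "\<And>i. \<epsilon> i = 1 \<or> \<epsilon> i = -1"
    and p: "fst X = 1" "last_coord X = 0" and r: "fst Y = 0" "last_coord Y = 1"
    and null: "std_form \<epsilon> X X = 0" "std_form \<epsilon> X Y = 0" "std_form \<epsilon> Y Y = 0"
    and h: "h (fst (snd X)) = fst (snd (snd (snd X)))"
      "\<And>i. partial_deriv h i (fst (snd X)) = \<epsilon> i * fst (snd Y) $ i"
  shows "ham_p \<epsilon> h (fst (snd X)) = X" "ham_r \<epsilon> h (fst (snd X)) = (Y :: 'n hcoords)"
proof -
  have \<epsilon>2': "\<epsilon> i * (\<epsilon> i * x) = x" for i x using \<epsilon>[of i] by auto
  obtain u a m where X: "X = (1, u, a, m, 0)" using p by (cases X) simp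
  obtain q b k where Y: "Y = (0, q, b, k, 1)" using r by (cases Y) simp
  have hu: "h u = m" "\<And>i. partial_deriv h i u = \<epsilon> i * q $ i" using h by (simp_all add: X Y)
  show "ham_p \<epsilon> h (fst (snd X)) = X"
    using null(1) by (simp add: X ham_p_def hu sqnorm_def power2_eq_square mult.assoc)
  show "ham_r \<epsilon> h (fst (snd X)) = Y"
    using null(2,3)
    by (simp add: X Y ham_r_def hu sqnorm_def grad_def power2_eq_square vec_eq_iff \<epsilon>2' ac_simps)
qed

text \<open>The neighbourhood shrinks twice: first so that a frame dual to the first and last normal
  coordinates exists, then so that \<open>u\<close> is invertible.\<close>

lemma legendre_imp_hamiltonian_ruled:
  fixes L :: "'n::finite line_family"
  assumes ruled: "ruled_hypersurface U L" and V: "V \<subseteq> U" "v\<^sub>0 \<in> V"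
    and B: "nondegenerate_form B" and leg: "legendre_submanifold B V L"
  shows "\<exists>V'. open V' \<and> v\<^sub>0 \<in> V' \<and> V' \<subseteq> V \<and> hamiltonian_ruled V' L"
proof -
  have "v\<^sub>0 \<in> U" using V by blast
  show ?thesis
  proof (rule ruled_hypersurface_immersion[OF ruled \<open>v\<^sub>0 \<in> U\<close>])
    fix V1 X Y s t
    assume V1: "v\<^sub>0 \<in> V1" and fr1: "local_frame L V1 X Y" and x0: "s *\<^sub>R X v\<^sub>0 + t *\<^sub>R Y v\<^sub>0 \<noteq> 0" and
      imm: "\<And>w. s *\<^sub>R frechet_derivative X (at v\<^sub>0) w + t *\<^sub>R frechet_derivative Y (at v\<^sub>0) w \<in> L v\<^sub>0
        \<Longrightarrow> w = 0"
    txt \<open>At the point \<open>x\<close> of the generator the ruled hypersurface is immersed; placing \<open>x\<close> at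
      \<open>[1 : 0 : \<dots> : 0]\<close> is what makes the coordinate map \<open>u\<close> below a local diffeomorphism.\<close>
    define x where "x = s *\<^sub>R X v\<^sub>0 + t *\<^sub>R Y v\<^sub>0"
    have opV1: "open V1" and smXY: "smooth_on V1 X" "smooth_on V1 Y" and
      line: "is_line (L v\<^sub>0)" and L1: "\<And>v. v \<in> V1 \<Longrightarrow> L v = span {X v, Y v}"
      using fr1 V1 by (auto simp: local_frame_def)
    have sect: "s *\<^sub>R X v + t *\<^sub>R Y v \<in> L v" if "v \<in> V1" for v
      unfolding L1[OF that] span_pair_iff by blast
    have xL: "x \<in> L v\<^sub>0" unfolding x_def by (rule sect[OF V1])
    have "x \<noteq> 0" using x0 by (simp only: x_def not_False_eq_True)
    then obtain y where y: "L v\<^sub>0 = span {x, y}" by (rule line_basis_extension[OF line xL])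
    have yL: "y \<in> L v\<^sub>0" unfolding y by (simp add: span_base)
    have opV: "open V" using leg unfolding legendre_submanifold_def smooth_line_family_def by blast
    have "L v\<^sub>0 \<in> fano B" using leg V(2) unfolding legendre_submanifold_def by blast
    then have sub: "subspace (L v\<^sub>0)" "L v\<^sub>0 \<subseteq> quadric B" by (simp_all add: fano_def is_line_def)
    note iso = isotropic_subspace[OF B sub]
    obtain \<epsilon> :: "'n \<Rightarrow> real" and A where \<epsilon>: "\<And>i. \<epsilon> i = 1 \<or> \<epsilon> i = -1"
      and A: "linear A" "bij A" and Ax: "A x = (1, 0, 0, 0, 0)" and Ay: "A y = (0, 0, 0, 0, 1)"
      and BA: "\<And>z w. B z w = std_form \<epsilon> (A z) (A w)"
      using nondegenerate_form_normal_form[OF B iso[OF xL xL] iso[OF xL yL] iso[OF yL yL]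
          line_basis_independent[OF line[unfolded y]]] by metis
    let ?f = "\<lambda>x. fst (A x)" and ?g = "\<lambda>x. last_coord (A x)"
    have inj0: "z = 0" if z: "z \<in> L v\<^sub>0" "?f z = 0" "?g z = 0" for z
    proof -
      obtain a b where ab: "z = a *\<^sub>R x + b *\<^sub>R y" using z(1) unfolding y span_pair_iff by blast
      show "z = 0"
        using z(2,3) by (simp add: ab linear_add[OF A(1)] linear_scale[OF A(1)] Ax Ay)
    qed
    obtain N0 P R where N0: "v\<^sub>0 \<in> N0" "N0 \<subseteq> V1" and fr0: "dual_frame ?f ?g L N0 P R"
      by (rule exists_dual_frame[OF fr1 linear_first_last_coord[OF A(1)] V1 inj0])
    have opN0: "open N0" using fr0 by (simp add: dual_frame_def local_frame_def)
    define N where "N = N0 \<inter> V"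
    have N: "open N" "v\<^sub>0 \<in> N" "N \<subseteq> V" using opN0 opV N0 V by (auto simp: N_def)
    have fr: "dual_frame ?f ?g L N P R"
      by (rule dual_frame_subset[OF fr0 N(1)]) (simp add: N_def)
    have smPR: "smooth_on N P" "smooth_on N R" and LN: "\<And>v. v \<in> N \<Longrightarrow> L v = span {P v, R v}"
      and dual: "\<And>v. v \<in> N \<Longrightarrow> fst (A (P v)) = 1" "\<And>v. v \<in> N \<Longrightarrow> last_coord (A (P v)) = 0"
        "\<And>v. v \<in> N \<Longrightarrow> fst (A (R v)) = 0" "\<And>v. v \<in> N \<Longrightarrow> last_coord (A (R v)) = 1"
      using fr by (auto simp: dual_frame_def local_frame_def)
    let ?P = "\<lambda>v. frechet_derivative P (at v)"
    have dP: "(P has_derivative ?P v) (at v)" if "v \<in> N" for v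
      using dual_frame_has_derivative(1)[OF fr that] .
    have bA: "bounded_linear A" using A(1) by (simp add: linear_conv_bounded_linear)
    define u where "u v = fst (snd (A (P v)))" for v
    define k where "k v = fst (snd (snd (snd (A (P v)))))" for v
    define q where "q v = fst (snd (A (R v)))" for v
    have smAP: "smooth_on N (\<lambda>v. A (P v))" by (rule smooth_on_linear[OF N(1) bA smPR(1)])
    have smu: "smooth_on N u"
      unfolding u_def
      by (rule smooth_on_linear[OF N(1) bounded_linear_fst_comp[OF bounded_linear_snd] smAP])
    have smk: "smooth_on N k"
      unfolding k_def
      by (rule smooth_on_linear[OF N(1) bounded_linear_fst_comp[OF bounded_linear_snd_comp[OF
              bounded_linear_snd_comp[OF bounded_linear_snd]]] smAP])
    have dAP: "((\<lambda>v. A (P v)) has_derivative (\<lambda>w. A (?P v w))) (at v)" if "v \<in> N" for v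
      by (rule bounded_linear.has_derivative[OF bA dP[OF that]])
    have du: "(u has_derivative (\<lambda>w. fst (snd (A (?P v w))))) (at v)" if "v \<in> N" for v
      unfolding u_def by (intro has_derivative_fst has_derivative_snd dAP[OF that])
    have dk: "(k has_derivative (\<lambda>w. fst (snd (snd (snd (A (?P v w))))))) (at v)" if "v \<in> N" for v
      unfolding k_def by (intro has_derivative_fst has_derivative_snd dAP[OF that])
    have Du: "frechet_derivative u (at v) w = fst (snd (A (?P v w)))" if "v \<in> N" for v w
      using frechet_derivative_at[OF du[OF that]] by (rule fun_cong[symmetric])
    have legN: "B (P v) (P v) = 0" "B (P v) (R v) = 0" "B (R v) (R v) = 0"
      "B (?P v w) (R v) = 0" "B (P v) (?P v w) = 0" if v: "v \<in> N" for v w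
    proof -
      have "v \<in> V" using v N(3) by blast
      from legendre_dual_frame[OF B leg fr v this]
      show "B (P v) (P v) = 0" "B (P v) (R v) = 0" "B (R v) (R v) = 0"
        "B (?P v w) (R v) = 0" "B (P v) (?P v w) = 0" by this+
    qed
    \<comment> \<open>The contact condition \<open>(dP, R) = 0\<close> in coordinates: the first and
      last coordinates of \<open>dP\<close> vanish by normalization, leaving \<open>dk\<close> as
      the sum of \<open>\<epsilon> i * q^i du^i\<close>.\<close>
    have k': "fst (snd (snd (snd (A (?P v w))))) = (\<Sum>i\<in>UNIV. \<epsilon> i * fst (snd (A (?P v w))) $ i * q v $ i)"
      if v: "v \<in> N" for v w
      using legN(4)[OF v, of w] dual(3,4)[OF v] dual_frame_derivative_coords(1,2)[OF fr v, of w]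
      unfolding BA q_def by (cases "A (?P v w)"; cases "A (R v)") simp
    \<comment> \<open>If \<open>du\<close> kills \<open>w\<close>, so does \<open>dP\<close>:
      normalization handles the outer coordinates, the formula for \<open>dk\<close> the fourth, and
      \<open>(P, dP) = 0\<close> at \<open>P = [1 : 0 : ... : 0]\<close> the third.\<close>
    have inj: "inj (frechet_derivative u (at v\<^sub>0))"
    proof -
      have "w = 0" if w: "frechet_derivative u (at v\<^sub>0) w = 0" for w
      proof -
        have Pw: "P v\<^sub>0 = x"
          using dual_frame_expand[OF fr N(2) xL] by (simp add: Ax)
        obtain a1 a2 a3 a4 a5 where APw: "A (?P v\<^sub>0 w) = (a1, a2, a3, a4, a5)" by (cases "A (?P v\<^sub>0 w)")
        have "a2 = 0" using w Du[OF N(2)] by (simp add: APw)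
        moreover have "a1 = 0" "a5 = 0"
          using dual_frame_derivative_coords(1,2)[OF fr N(2), of w] by (simp_all add: APw)
        moreover have "a4 = 0" using k'[OF N(2), of w] \<open>a2 = 0\<close> by (simp add: APw)
        moreover have "a3 = 0"
          using legN(5)[OF N(2), of w] by (simp add: BA Pw Ax APw)
        ultimately have "A (?P v\<^sub>0 w) = 0" by (simp add: APw zero_prod_def)
        then have P0: "?P v\<^sub>0 w = 0" using A by (metis bij_is_inj injD linear_0)
        \<comment> \<open>This section passes through \<open>x\<close>, where the functionals are 1
          and 0, so modulo the line its derivative along \<open>w\<close> is that of
          \<open>P\<close>, which is zero; the immersion condition at \<open>x\<close>
          applies.\<close>
        have "((\<lambda>v. s *\<^sub>R X v + t *\<^sub>R Y v) has_derivative
            (\<lambda>w. s *\<^sub>R frechet_derivative X (at v\<^sub>0) w + t *\<^sub>R frechet_derivative Y (at v\<^sub>0) w)) (at v\<^sub>0)"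
          by (intro has_derivative_add has_derivative_scaleR_right smooth_on_has_derivative[OF smXY(1) V1]
              smooth_on_has_derivative[OF smXY(2) V1])
        from dual_frame_section_derivative[OF fr N(2) this opV1 V1 sect, of w]
        have "- (s *\<^sub>R frechet_derivative X (at v\<^sub>0) w + t *\<^sub>R frechet_derivative Y (at v\<^sub>0) w) \<in> L v\<^sub>0"
          unfolding x_def[symmetric] Ax P0 by simp
        from subspace_neg[OF sub(1) this, unfolded minus_minus] show "w = 0" by (rule imm)
      qed
      then show ?thesis
        using linear_injective_0[OF has_derivative_linear[OF smooth_on_has_derivative[OF smu N(2)]]]
        by blast
    qed
    show ?thesis
    proof (rule smooth_local_inverse[OF N(1) smu N(2) inj])
      fix V' W \<psi> \<psi>'
      assume V': "open V'" "v\<^sub>0 \<in> V'" "V' \<subseteq> N" "open W" and uV': "u ` V' = W" "\<psi> ` W \<subseteq> V'"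
        and \<psi>u: "\<And>x. x \<in> V' \<Longrightarrow> \<psi> (u x) = x"
        and d\<psi>: "\<And>y. y \<in> W \<Longrightarrow> (\<psi> has_derivative \<psi>' y) (at y)"
        and inv: "\<And>y d. y \<in> W \<Longrightarrow> frechet_derivative u (at (\<psi> y)) (\<psi>' y d) = d"
        and sm: "\<And>g :: real ^ 'n \<Rightarrow> real. smooth_on N g \<Longrightarrow> smooth_on W (\<lambda>y. g (\<psi> y))"
      \<comment> \<open>The density is the fourth coordinate of \<open>P\<close>, expressed in the
        local coordinates \<open>u\<close>.\<close>
      define h where "h y = k (\<psi> y)" for y
      have smh: "smooth_on W h" unfolding h_def by (rule sm[OF smk])
      \<comment> \<open>Evaluates the formula for \<open>dk\<close> on
        \<open>\<psi>' (u v) (axis i 1)\<close>, the vector that \<open>du\<close> maps to the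
        \<open>i\<close>-th axis.\<close>
      have h': "partial_deriv h i (u v) = \<epsilon> i * q v $ i" if v: "v \<in> V'" for v i
      proof -
        have vN: "v \<in> N" and uW: "u v \<in> W" using v V'(3) uV'(1) by blast+
        have "(h has_derivative (\<lambda>d. fst (snd (snd (snd (A (?P v (\<psi>' (u v) d)))))))) (at (u v))"
          unfolding h_def
          by (rule has_derivative_compose[OF d\<psi>[OF uW]]) (simp add: \<psi>u[OF v] dk[OF vN])
        then have "partial_deriv h i (u v) = fst (snd (snd (snd (A (?P v (\<psi>' (u v) (axis i 1)))))))"
          unfolding partial_deriv_def by (rule fun_cong[OF frechet_derivative_at[symmetric]])
        also have "\<dots> = (\<Sum>j\<in>UNIV. \<epsilon> j * axis i 1 $ j * q v $ j)"
          using inv[OF uW, of "axis i 1"] by (simp add: k'[OF vN] \<psi>u[OF v] Du[OF vN])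
        also have "\<dots> = \<epsilon> i * q v $ i"
          by (simp add: axis_def if_distrib[where f = "\<lambda>x. _ * x"] if_distrib[where f = "\<lambda>x. x * _"]
              cong: if_cong)
        finally show ?thesis .
      qed
      have line_eq: "A ` L v = ham_line \<epsilon> h (u v)" if v: "v \<in> V'" for v
      proof -
        have vN: "v \<in> N" using v V'(3) by blast
        have "ham_p \<epsilon> h (u v) = A (P v)" "ham_r \<epsilon> h (u v) = A (R v)"
          unfolding u_def
          by (rule ham_line_of_normal_frame[OF \<epsilon> dual(1-4)[OF vN] legN(1-3)[OF vN, unfolded BA]];
              simp add: h'[OF v, unfolded u_def] q_def h_def \<psi>u[OF v, unfolded u_def] k_def)+
        then show ?thesis
          unfolding ham_line_def LN[OF vN] using linear_span_image[OF A(1), of "{P v, R v}"] by simp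
      qed
      have "(\<lambda>v. A ` L v) ` V' = ham_line \<epsilon> h ` W"
        unfolding uV'(1)[symmetric] image_image by (rule image_cong[OF refl line_eq])
      then have "hamiltonian_ruled V' L"
        unfolding hamiltonian_ruled_def using \<epsilon> V'(4) smh A by blast
      then show ?thesis using V' N(3) by blast
    qed
  qed
qed

section \<open>The local equivalence near a generator\<close>

theorem theorem6:
  fixes U :: "(real ^ 'n::finite) set" and L :: "'n line_family" and v\<^sub>0 :: "real ^ 'n"
  assumes "ruled_hypersurface U L" and "v\<^sub>0 \<in> U"
  shows "(\<exists>V. open V \<and> v\<^sub>0 \<in> V \<and> V \<subseteq> U \<and> hamiltonian_ruled V L) \<longleftrightarrow>
         (\<exists>V. open V \<and> v\<^sub>0 \<in> V \<and> V \<subseteq> U \<and>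
            (\<exists>B. nondegenerate_form B \<and> legendre_submanifold B V L))"
proof
  assume "\<exists>V. open V \<and> v\<^sub>0 \<in> V \<and> V \<subseteq> U \<and> hamiltonian_ruled V L"
  then obtain V where V: "open V" "v\<^sub>0 \<in> V" "V \<subseteq> U" "hamiltonian_ruled V L" by (elim exE conjE)
  from hamiltonian_ruled_imp_legendre[OF assms(1) V(1,3,4)] V(1-3)
  show "\<exists>V. open V \<and> v\<^sub>0 \<in> V \<and> V \<subseteq> U \<and> (\<exists>B. nondegenerate_form B \<and> legendre_submanifold B V L)"
    by (intro exI[of _ V] conjI)
next
  assume "\<exists>V. open V \<and> v\<^sub>0 \<in> V \<and> V \<subseteq> U \<and> (\<exists>B. nondegenerate_form B \<and> legendre_submanifold B V L)"
  then obtain V B where V: "open V" "v\<^sub>0 \<in> V" "V \<subseteq> U"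
    and B: "nondegenerate_form B" "legendre_submanifold B V L" by (elim exE conjE)
  from legendre_imp_hamiltonian_ruled[OF assms(1) V(3,2) B]
  obtain V' where "open V'" "v\<^sub>0 \<in> V'" "V' \<subseteq> V" "hamiltonian_ruled V' L" by (elim exE conjE)
  then show "\<exists>V. open V \<and> v\<^sub>0 \<in> V \<and> V \<subseteq> U \<and> hamiltonian_ruled V L"
    using V(3) by (intro exI[of _ V'] conjI) simp_all
qed

end
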